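(* Let $\mathcal A$ be a triangulated monoidal category. Let $\varepsilon:\mathbf C\to\mathbb 1$ be a counital idempotent and $\varepsilon^\star:\mathbb 1\to\mathbf C^\star$ a unital idempotent in $\mathcal A$ (no relation between them is assumed). Let $(\mathbf U,\eta:\mathbb 1\to\mathbf U)$ be the unital idempotent complementary to $\mathbf C$, and $(\mathbf U^\star,\eta^\star:\mathbf U^\star\to\mathbb 1)$ the counital idempotent complementary to $\mathbf C^\star$. Let $\mathbf T(\mathbf C,\mathbf C^\star):=\mathrm{Cone}(\varepsilon^\star\circ\varepsilon:\mathbf C\to\mathbf C^\star)$ and $\mathbf T(\mathbf U^\star,\mathbf U):=\mathrm{Cone}(\eta\circ\eta^\star:\mathbf U^\star\to\mathbf U)$. Then $\mathbf T(\mathbf C,\mathbf C^\star)\cong\mathbf T(\mathbf U^\star,\mathbf U)$. Denote this object by $\mathbf T$. Furthermore: (1) If $\mathbf C\otimes\mathbf U^\star\cong 0\cong\mathbf U^\star\otimes\mathbf C$, then $\mathbf T\cong\mathbf U\otimes\mathbf C^\star$ has the structure of a unital idempotent in $\mathcal A$, with complementary idempotent $\mathbf C\oplus\mathbf U^\star$. (2) If $\mathbf U\otimes\mathbf C^\star\cong 0\cong\mathbf C^\star\otimes\mathbf U$, then $\mathbf T[-1]\cong\mathbf C\otimes\mathbf U^\star$ has the structure of a counital idempotent in $\mathcal A$, with complementary idempotent $\mathbf U\oplus\mathbf C^\star$.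
   Context: A triangulated monoidal category is an additive category $\mathcal A$ equipped with: a triangulated structure (an invertible suspension endofunctor $[1]$ and a class of distinguished triangles satisfying the usual axioms, including Verdier's octahedral axiom); a monoidal structure $(\otimes,\mathbb 1)$ with left unitor $\lambda$; and natural isomorphisms $\alpha_A:A\otimes\mathbb 1[1]\to A[1]$ and $\beta_A:\mathbb 1[1]\otimes A\to A\otimes\mathbb 1[1]$ such that (suppressing associators) $\alpha_{\mathbb 1}=\lambda_{\mathbb 1[1]}$, $\alpha_{A[1]}\circ(\alpha_A\otimes\mathrm{Id}_{\mathbb 1[1]})=\alpha_A[1]\circ\alpha_{A\otimes\mathbb 1[1]}$, $\beta_{\mathbb 1[1]}=-\mathrm{Id}$, and $\beta_{A\otimes B}=(\mathrm{Id}_A\otimes\beta_B)\circ(\beta_A\otimes\mathrm{Id}_B)$. Further, for each distinguished triangle $A\to B\to C\to A[1]$ and each object $D$, the triangles $D\otimes A\to D\otimes B\to D\otimes C\to (D\otimes A)[1]$ and $A\otimes D\to B\otimes D\to C\otimes D\to (A\otimes D)[1]$ are distinguished, where the identifications $D\otimes A[1]\cong(D\otimes A)[1]$ and $A[1]\otimes D\cong(A\otimes D)[1]$ are built from $\alpha,\beta$ and the associator. A pair of complementary idempotents in $\mathcal A$ is a pair of objects $(\mathbf C,\mathbf U)$ with $\mathbf C\otimes\mathbf U\cong 0\cong\mathbf U\otimes\mathbf C$, together with a distinguished triangle $\mathbf C\xrightarrow{\varepsilon}\mathbb 1\xrightarrow{\eta}\mathbf U\xrightarrow{\delta}\mathbf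 C[1]$. In this case $(\mathbf U,\eta)$ is called a unital idempotent, $(\mathbf C,\varepsilon)$ a counital idempotent, and each is called the complementary idempotent of the other. $\mathrm{Cone}(f)$ denotes an object $C$ completing $f:A\to B$ to a distinguished triangle $A\xrightarrow{f}B\to C\to A[1]$; it is unique up to isomorphism. *)

theory Defs
  imports "HOL-Algebra.Group"
begin

section \<open>Categories\<close>

record ('o, 'm) cat =
  Obj :: "'o set"
  Arr :: "'m set"
  Dom :: "'m \<Rightarrow> 'o"
  Cod :: "'m \<Rightarrow> 'o"
  Id :: "'o \<Rightarrow> 'm"
  Comp :: "'m \<Rightarrow> 'm \<Rightarrow> 'm"  (infixr \<open>\<cdot>\<index>\<close> 70)

definition Hom :: "('o, 'm, 'z) cat_scheme \<Rightarrow> 'o \<Rightarrow> 'o \<Rightarrow> 'm set" where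
  "Hom \<A> A B = {f \<in> Arr \<A>. Dom \<A> f = A \<and> Cod \<A> f = B}"

locale category =
  fixes \<A> :: "('o, 'm, 'z) cat_scheme" (structure)
  assumes dom_cod: "f \<in> Arr \<A> \<Longrightarrow> Dom \<A> f \<in> Obj \<A> \<and> Cod \<A> f \<in> Obj \<A>"
    and id_hom: "A \<in> Obj \<A> \<Longrightarrow> Id \<A> A \<in> Hom \<A> A A"
    and comp_hom: "\<lbrakk>f \<in> Hom \<A> A B; g \<in> Hom \<A> B C\<rbrakk> \<Longrightarrow> g \<cdot> f \<in> Hom \<A> A C"
    and id_left: "f \<in> Hom \<A> A B \<Longrightarrow> Id \<A> B \<cdot> f = f"
    and id_right: "f \<in> Hom \<A> A B \<Longrightarrow> f \<cdot> Id \<A> A = f"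
    and comp_assoc: "\<lbrakk>f \<in> Hom \<A> A B; g \<in> Hom \<A> B C; h \<in> Hom \<A> C D\<rbrakk>
      \<Longrightarrow> (h \<cdot> g) \<cdot> f = h \<cdot> (g \<cdot> f)"

definition inverse_arrows :: "('o, 'm, 'z) cat_scheme \<Rightarrow> 'm \<Rightarrow> 'm \<Rightarrow> bool" where
  "inverse_arrows \<A> f g \<longleftrightarrow> f \<in> Arr \<A> \<and> g \<in> Hom \<A> (Cod \<A> f) (Dom \<A> f) \<and>
     g \<cdot>\<^bsub>\<A>\<^esub> f = Id \<A> (Dom \<A> f) \<and> f \<cdot>\<^bsub>\<A>\<^esub> g = Id \<A> (Cod \<A> f)"

definition is_iso :: "('o, 'm, 'z) cat_scheme \<Rightarrow> 'm \<Rightarrow> bool" where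
  "is_iso \<A> f \<longleftrightarrow> (\<exists>g. inverse_arrows \<A> f g)"

definition inv_arr :: "('o, 'm, 'z) cat_scheme \<Rightarrow> 'm \<Rightarrow> 'm"  (\<open>(_\<^sup>-\<^sup>1\<index>)\<close> [1000] 999) where
  "f\<^sup>-\<^sup>1\<^bsub>\<A>\<^esub> = (THE g. inverse_arrows \<A> f g)"

definition isomorphic :: "('o, 'm, 'z) cat_scheme \<Rightarrow> 'o \<Rightarrow> 'o \<Rightarrow> bool"  (infix \<open>\<simeq>\<index>\<close> 50) where
  "A \<simeq>\<^bsub>\<A>\<^esub> B \<longleftrightarrow> (\<exists>f \<in> Hom \<A> A B. is_iso \<A> f)"

definition zero_object :: "('o, 'm, 'z) cat_scheme \<Rightarrow> 'o \<Rightarrow> bool" where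
  "zero_object \<A> Z \<longleftrightarrow> Z \<in> Obj \<A> \<and>
     (\<forall>A \<in> Obj \<A>. (\<exists>!f. f \<in> Hom \<A> A Z) \<and> (\<exists>!f. f \<in> Hom \<A> Z A))"

definition isomorphic_to_zero :: "('o, 'm, 'z) cat_scheme \<Rightarrow> 'o \<Rightarrow> bool" where
  "isomorphic_to_zero \<A> A \<longleftrightarrow> (\<exists>Z. zero_object \<A> Z \<and> A \<simeq>\<^bsub>\<A>\<^esub> Z)"


section \<open>Additive categories\<close>

record ('o, 'm) additive_cat = "('o, 'm) cat" +
  Add :: "'m \<Rightarrow> 'm \<Rightarrow> 'm"  (infixl \<open>\<^bold>+\<index>\<close> 65)
  Zero :: "'o \<Rightarrow> 'o \<Rightarrow> 'm"

definition hom_group :: "('o, 'm, 'z) additive_cat_scheme \<Rightarrow> 'o \<Rightarrow> 'o \<Rightarrow> 'm monoid" where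
  "hom_group \<A> A B = \<lparr>carrier = Hom \<A> A B, monoid.mult = Add \<A>, one = Zero \<A> A B\<rparr>"

definition neg_arr :: "('o, 'm, 'z) additive_cat_scheme \<Rightarrow> 'm \<Rightarrow> 'm"  (\<open>\<^bold>-\<index> _\<close> [81] 80) where
  "\<^bold>-\<^bsub>\<A>\<^esub> f = m_inv (hom_group \<A> (Dom \<A> f) (Cod \<A> f)) f"

definition biproduct ::
    "('o, 'm, 'z) additive_cat_scheme \<Rightarrow> 'o \<Rightarrow> 'o \<Rightarrow> 'o \<Rightarrow> 'm \<Rightarrow> 'm \<Rightarrow> 'm \<Rightarrow> 'm \<Rightarrow> bool" where
  "biproduct \<A> X A B i j p q \<longleftrightarrow>
     i \<in> Hom \<A> A X \<and> j \<in> Hom \<A> B X \<and> p \<in> Hom \<A> X A \<and> q \<in> Hom \<A> X B \<and>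
     p \<cdot>\<^bsub>\<A>\<^esub> i = Id \<A> A \<and> q \<cdot>\<^bsub>\<A>\<^esub> j = Id \<A> B \<and>
     p \<cdot>\<^bsub>\<A>\<^esub> j = Zero \<A> B A \<and> q \<cdot>\<^bsub>\<A>\<^esub> i = Zero \<A> A B \<and>
     (i \<cdot>\<^bsub>\<A>\<^esub> p) \<^bold>+\<^bsub>\<A>\<^esub> (j \<cdot>\<^bsub>\<A>\<^esub> q) = Id \<A> X"

text \<open>\<open>direct_sum \<A> X A B\<close> says that \<open>X\<close> is a direct sum of \<open>A\<close> and \<open>B\<close>; like cones below,
  direct sums are only determined up to isomorphism.\<close>

definition direct_sum :: "('o, 'm, 'z) additive_cat_scheme \<Rightarrow> 'o \<Rightarrow> 'o \<Rightarrow> 'o \<Rightarrow> bool" where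
  "direct_sum \<A> X A B \<longleftrightarrow> (\<exists>i j p q. biproduct \<A> X A B i j p q)"

locale additive_category = category \<A>
  for \<A> :: "('o, 'm, 'z) additive_cat_scheme" (structure) +
  assumes hom_comm_group: "\<lbrakk>A \<in> Obj \<A>; B \<in> Obj \<A>\<rbrakk> \<Longrightarrow> comm_group (hom_group \<A> A B)"
    and comp_add_left: "\<lbrakk>f \<in> Hom \<A> A B; g \<in> Hom \<A> B C; g' \<in> Hom \<A> B C\<rbrakk>
      \<Longrightarrow> (g \<^bold>+ g') \<cdot> f = (g \<cdot> f) \<^bold>+ (g' \<cdot> f)"
    and comp_add_right: "\<lbrakk>f \<in> Hom \<A> A B; f' \<in> Hom \<A> A B; g \<in> Hom \<A> B C\<rbrakk>
      \<Longrightarrow> g \<cdot> (f \<^bold>+ f') = (g \<cdot> f) \<^bold>+ (g \<cdot> f')"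
    and ex_zero_object: "\<exists>Z. zero_object \<A> Z"
    and ex_direct_sum: "\<lbrakk>A \<in> Obj \<A>; B \<in> Obj \<A>\<rbrakk> \<Longrightarrow> \<exists>X. direct_sum \<A> X A B"


section \<open>Triangulated categories\<close>

record ('o, 'm) triangulated_cat = "('o, 'm) additive_cat" +
  ShiftO :: "'o \<Rightarrow> 'o"  (\<open>(_\<langle>1\<rangle>\<index>)\<close> [1000] 999)
  ShiftA :: "'m \<Rightarrow> 'm"  (\<open>(_\<lbrakk>1\<rbrakk>\<index>)\<close> [1000] 999)
  Dist :: "('m \<times> 'm \<times> 'm) set"

definition UnshiftO :: "('o, 'm, 'z) triangulated_cat_scheme \<Rightarrow> 'o \<Rightarrow> 'o"
    (\<open>(_\<langle>-1\<rangle>\<index>)\<close> [1000] 999) where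
  "A\<langle>-1\<rangle>\<^bsub>\<A>\<^esub> = inv_into (Obj \<A>) (ShiftO \<A>) A"

definition distinguished ::
    "('o, 'm, 'z) triangulated_cat_scheme \<Rightarrow> 'o \<Rightarrow> 'o \<Rightarrow> 'o \<Rightarrow> 'm \<Rightarrow> 'm \<Rightarrow> 'm \<Rightarrow> bool" where
  "distinguished \<A> A B C f g h \<longleftrightarrow>
     f \<in> Hom \<A> A B \<and> g \<in> Hom \<A> B C \<and> h \<in> Hom \<A> C (A\<langle>1\<rangle>\<^bsub>\<A>\<^esub>) \<and> (f, g, h) \<in> Dist \<A>"

definition cone :: "('o, 'm, 'z) triangulated_cat_scheme \<Rightarrow> 'm \<Rightarrow> 'o \<Rightarrow> bool" where
  "cone \<A> f C \<longleftrightarrow> (\<exists>g h. distinguished \<A> (Dom \<A> f) (Cod \<A> f) C f g h)"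

locale triangulated_category = additive_category \<A>
  for \<A> :: "('o, 'm, 'z) triangulated_cat_scheme" (structure) +
  assumes shift_hom: "f \<in> Hom \<A> A B \<Longrightarrow> f\<lbrakk>1\<rbrakk> \<in> Hom \<A> (A\<langle>1\<rangle>) (B\<langle>1\<rangle>)"
    and shift_id: "A \<in> Obj \<A> \<Longrightarrow> (Id \<A> A)\<lbrakk>1\<rbrakk> = Id \<A> (A\<langle>1\<rangle>)"
    and shift_comp: "\<lbrakk>f \<in> Hom \<A> A B; g \<in> Hom \<A> B C\<rbrakk> \<Longrightarrow> (g \<cdot> f)\<lbrakk>1\<rbrakk> = g\<lbrakk>1\<rbrakk> \<cdot> f\<lbrakk>1\<rbrakk>"
    and shift_add: "\<lbrakk>f \<in> Hom \<A> A B; g \<in> Hom \<A> A B\<rbrakk> \<Longrightarrow> (f \<^bold>+ g)\<lbrakk>1\<rbrakk> = f\<lbrakk>1\<rbrakk> \<^bold>+ g\<lbrakk>1\<rbrakk>"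
    and shift_bij_obj: "bij_betw (ShiftO \<A>) (Obj \<A>) (Obj \<A>)"
    and shift_bij_arr: "bij_betw (ShiftA \<A>) (Arr \<A>) (Arr \<A>)"
    and TR1_iso: "\<lbrakk>distinguished \<A> A B C f g h;
        a \<in> Hom \<A> A A'; b \<in> Hom \<A> B B'; c \<in> Hom \<A> C C'; is_iso \<A> a; is_iso \<A> b; is_iso \<A> c;
        f' \<in> Hom \<A> A' B'; g' \<in> Hom \<A> B' C'; h' \<in> Hom \<A> C' (A'\<langle>1\<rangle>);
        f' \<cdot> a = b \<cdot> f; g' \<cdot> b = c \<cdot> g; h' \<cdot> c = a\<lbrakk>1\<rbrakk> \<cdot> h\<rbrakk>
      \<Longrightarrow> distinguished \<A> A' B' C' f' g' h'"
    and TR1_id: "\<lbrakk>A \<in> Obj \<A>; zero_object \<A> Z\<rbrakk>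
      \<Longrightarrow> distinguished \<A> A A Z (Id \<A> A) (Zero \<A> A Z) (Zero \<A> Z (A\<langle>1\<rangle>))"
    and TR1_ex: "f \<in> Hom \<A> A B \<Longrightarrow> \<exists>C g h. distinguished \<A> A B C f g h"
    and TR2: "\<lbrakk>f \<in> Hom \<A> A B; g \<in> Hom \<A> B C; h \<in> Hom \<A> C (A\<langle>1\<rangle>)\<rbrakk>
      \<Longrightarrow> distinguished \<A> A B C f g h \<longleftrightarrow> distinguished \<A> B C (A\<langle>1\<rangle>) g h (\<^bold>- f\<lbrakk>1\<rbrakk>)"
    and TR3: "\<lbrakk>distinguished \<A> A B C f g h; distinguished \<A> A' B' C' f' g' h';
        a \<in> Hom \<A> A A'; b \<in> Hom \<A> B B'; f' \<cdot> a = b \<cdot> f\<rbrakk>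
      \<Longrightarrow> \<exists>c \<in> Hom \<A> C C'. g' \<cdot> b = c \<cdot> g \<and> h' \<cdot> c = a\<lbrakk>1\<rbrakk> \<cdot> h"
    and TR4: "\<lbrakk>f \<in> Hom \<A> A B; g \<in> Hom \<A> B C;
        distinguished \<A> A B D f u u'; distinguished \<A> B C E g v v';
        distinguished \<A> A C F (g \<cdot> f) w w'\<rbrakk>
      \<Longrightarrow> \<exists>k l. distinguished \<A> D F E k l (u\<lbrakk>1\<rbrakk> \<cdot> v') \<and>
            k \<cdot> u = w \<cdot> g \<and> w' \<cdot> k = u' \<and> l \<cdot> w = v \<and> v' \<cdot> l = f\<lbrakk>1\<rbrakk> \<cdot> w'"


section \<open>Triangulated monoidal categories\<close>

record ('o, 'm) triangulated_monoidal_cat = "('o, 'm) triangulated_cat" +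
  TensorO :: "'o \<Rightarrow> 'o \<Rightarrow> 'o"  (infixl \<open>\<otimes>\<^sub>o\<index>\<close> 72)
  TensorA :: "'m \<Rightarrow> 'm \<Rightarrow> 'm"  (infixl \<open>\<otimes>\<^sub>a\<index>\<close> 72)
  Unit :: 'o  (\<open>\<^bold>1\<index>\<close>)
  Assoc :: "'o \<Rightarrow> 'o \<Rightarrow> 'o \<Rightarrow> 'm"  (\<open>\<a>\<index>\<close>)
  LUnit :: "'o \<Rightarrow> 'm"  (\<open>\<^bold>\<lambda>\<index>\<close>)
  RUnit :: "'o \<Rightarrow> 'm"  (\<open>\<^bold>\<rho>\<index>\<close>)
  Alpha :: "'o \<Rightarrow> 'm"  (\<open>\<^bold>\<alpha>\<index>\<close>)
  Beta :: "'o \<Rightarrow> 'm"  (\<open>\<^bold>\<beta>\<index>\<close>)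

text \<open>Records extend linearly, so the monoidal data sit on top of the triangulated ones, but the
  next locale does not constrain the latter. The components \<open>\<^bold>\<alpha> A : A \<otimes> \<^bold>1[1] \<rightarrow> A[1]\<close> and
  \<open>\<^bold>\<beta> A : \<^bold>1[1] \<otimes> A \<rightarrow> A \<otimes> \<^bold>1[1]\<close> are only used in \<open>triangulated_monoidal_category\<close>.\<close>

locale monoidal_category = category \<A>
  for \<A> :: "('o, 'm, 'z) triangulated_monoidal_cat_scheme" (structure) +
  assumes tensor_obj: "\<lbrakk>A \<in> Obj \<A>; B \<in> Obj \<A>\<rbrakk> \<Longrightarrow> A \<otimes>\<^sub>o B \<in> Obj \<A>"
    and tensor_hom: "\<lbrakk>f \<in> Hom \<A> A B; g \<in> Hom \<A> C D\<rbrakk>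
      \<Longrightarrow> f \<otimes>\<^sub>a g \<in> Hom \<A> (A \<otimes>\<^sub>o C) (B \<otimes>\<^sub>o D)"
    and tensor_id: "\<lbrakk>A \<in> Obj \<A>; B \<in> Obj \<A>\<rbrakk> \<Longrightarrow> Id \<A> A \<otimes>\<^sub>a Id \<A> B = Id \<A> (A \<otimes>\<^sub>o B)"
    and tensor_comp: "\<lbrakk>f \<in> Hom \<A> A B; g \<in> Hom \<A> B C; f' \<in> Hom \<A> A' B'; g' \<in> Hom \<A> B' C'\<rbrakk>
      \<Longrightarrow> (g \<cdot> f) \<otimes>\<^sub>a (g' \<cdot> f') = (g \<otimes>\<^sub>a g') \<cdot> (f \<otimes>\<^sub>a f')"
    and unit_obj: "\<^bold>1 \<in> Obj \<A>"
    and assoc_hom: "\<lbrakk>A \<in> Obj \<A>; B \<in> Obj \<A>; C \<in> Obj \<A>\<rbrakk>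
      \<Longrightarrow> \<a> A B C \<in> Hom \<A> ((A \<otimes>\<^sub>o B) \<otimes>\<^sub>o C) (A \<otimes>\<^sub>o (B \<otimes>\<^sub>o C))"
    and assoc_iso: "\<lbrakk>A \<in> Obj \<A>; B \<in> Obj \<A>; C \<in> Obj \<A>\<rbrakk> \<Longrightarrow> is_iso \<A> (\<a> A B C)"
    and assoc_natural: "\<lbrakk>f \<in> Hom \<A> A A'; g \<in> Hom \<A> B B'; h \<in> Hom \<A> C C'\<rbrakk>
      \<Longrightarrow> \<a> A' B' C' \<cdot> ((f \<otimes>\<^sub>a g) \<otimes>\<^sub>a h) = (f \<otimes>\<^sub>a (g \<otimes>\<^sub>a h)) \<cdot> \<a> A B C"
    and lunit_hom: "A \<in> Obj \<A> \<Longrightarrow> \<^bold>\<lambda> A \<in> Hom \<A> (\<^bold>1 \<otimes>\<^sub>o A) A"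
    and lunit_iso: "A \<in> Obj \<A> \<Longrightarrow> is_iso \<A> (\<^bold>\<lambda> A)"
    and lunit_natural: "f \<in> Hom \<A> A B \<Longrightarrow> \<^bold>\<lambda> B \<cdot> (Id \<A> \<^bold>1 \<otimes>\<^sub>a f) = f \<cdot> \<^bold>\<lambda> A"
    and runit_hom: "A \<in> Obj \<A> \<Longrightarrow> \<^bold>\<rho> A \<in> Hom \<A> (A \<otimes>\<^sub>o \<^bold>1) A"
    and runit_iso: "A \<in> Obj \<A> \<Longrightarrow> is_iso \<A> (\<^bold>\<rho> A)"
    and runit_natural: "f \<in> Hom \<A> A B \<Longrightarrow> \<^bold>\<rho> B \<cdot> (f \<otimes>\<^sub>a Id \<A> \<^bold>1) = f \<cdot> \<^bold>\<rho> A"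
    and pentagon: "\<lbrakk>A \<in> Obj \<A>; B \<in> Obj \<A>; C \<in> Obj \<A>; D \<in> Obj \<A>\<rbrakk>
      \<Longrightarrow> \<a> A B (C \<otimes>\<^sub>o D) \<cdot> \<a> (A \<otimes>\<^sub>o B) C D
          = (Id \<A> A \<otimes>\<^sub>a \<a> B C D) \<cdot> \<a> A (B \<otimes>\<^sub>o C) D \<cdot> (\<a> A B C \<otimes>\<^sub>a Id \<A> D)"
    and triangle: "\<lbrakk>A \<in> Obj \<A>; B \<in> Obj \<A>\<rbrakk>
      \<Longrightarrow> (Id \<A> A \<otimes>\<^sub>a \<^bold>\<lambda> B) \<cdot> \<a> A \<^bold>1 B = \<^bold>\<rho> A \<otimes>\<^sub>a Id \<A> B"

text \<open>The identifications, with \<open>S = \<^bold>1[1]\<close>,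
  \<open>D \<otimes> A[1] \<rightarrow> D \<otimes> (A \<otimes> S) \<rightarrow> (D \<otimes> A) \<otimes> S \<rightarrow> (D \<otimes> A)[1]\<close> and
  \<open>A[1] \<otimes> D \<rightarrow> (A \<otimes> S) \<otimes> D \<rightarrow> A \<otimes> (S \<otimes> D) \<rightarrow> A \<otimes> (D \<otimes> S) \<rightarrow> (A \<otimes> D) \<otimes> S \<rightarrow> (A \<otimes> D)[1]\<close>.\<close>

definition tensor_shift_left ::
    "('o, 'm, 'z) triangulated_monoidal_cat_scheme \<Rightarrow> 'o \<Rightarrow> 'o \<Rightarrow> 'm" where
  "tensor_shift_left \<A> D A =
     \<^bold>\<alpha>\<^bsub>\<A>\<^esub> (D \<otimes>\<^sub>o\<^bsub>\<A>\<^esub> A) \<cdot>\<^bsub>\<A>\<^esub>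
     (\<a>\<^bsub>\<A>\<^esub> D A (\<^bold>1\<^bsub>\<A>\<^esub>\<langle>1\<rangle>\<^bsub>\<A>\<^esub>))\<^sup>-\<^sup>1\<^bsub>\<A>\<^esub> \<cdot>\<^bsub>\<A>\<^esub>
     (Id \<A> D \<otimes>\<^sub>a\<^bsub>\<A>\<^esub> (\<^bold>\<alpha>\<^bsub>\<A>\<^esub> A)\<^sup>-\<^sup>1\<^bsub>\<A>\<^esub>)"

definition tensor_shift_right ::
    "('o, 'm, 'z) triangulated_monoidal_cat_scheme \<Rightarrow> 'o \<Rightarrow> 'o \<Rightarrow> 'm" where
  "tensor_shift_right \<A> A D =
     \<^bold>\<alpha>\<^bsub>\<A>\<^esub> (A \<otimes>\<^sub>o\<^bsub>\<A>\<^esub> D) \<cdot>\<^bsub>\<A>\<^esub>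
     (\<a>\<^bsub>\<A>\<^esub> A D (\<^bold>1\<^bsub>\<A>\<^esub>\<langle>1\<rangle>\<^bsub>\<A>\<^esub>))\<^sup>-\<^sup>1\<^bsub>\<A>\<^esub> \<cdot>\<^bsub>\<A>\<^esub>
     (Id \<A> A \<otimes>\<^sub>a\<^bsub>\<A>\<^esub> \<^bold>\<beta>\<^bsub>\<A>\<^esub> D) \<cdot>\<^bsub>\<A>\<^esub>
     \<a>\<^bsub>\<A>\<^esub> A (\<^bold>1\<^bsub>\<A>\<^esub>\<langle>1\<rangle>\<^bsub>\<A>\<^esub>) D \<cdot>\<^bsub>\<A>\<^esub>
     ((\<^bold>\<alpha>\<^bsub>\<A>\<^esub> A)\<^sup>-\<^sup>1\<^bsub>\<A>\<^esub> \<otimes>\<^sub>a\<^bsub>\<A>\<^esub> Id \<A> D)"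

text \<open>Exactness of the tensor product in each variable forces its additivity, which is
  therefore not listed.\<close>

locale triangulated_monoidal_category = triangulated_category \<A> + monoidal_category \<A>
  for \<A> :: "('o, 'm, 'z) triangulated_monoidal_cat_scheme" (structure) +
  assumes alpha_hom: "A \<in> Obj \<A> \<Longrightarrow> \<^bold>\<alpha> A \<in> Hom \<A> (A \<otimes>\<^sub>o \<^bold>1\<langle>1\<rangle>) (A\<langle>1\<rangle>)"
    and alpha_iso: "A \<in> Obj \<A> \<Longrightarrow> is_iso \<A> (\<^bold>\<alpha> A)"
    and alpha_natural: "f \<in> Hom \<A> A B \<Longrightarrow> \<^bold>\<alpha> B \<cdot> (f \<otimes>\<^sub>a Id \<A> (\<^bold>1\<langle>1\<rangle>)) = f\<lbrakk>1\<rbrakk> \<cdot> \<^bold>\<alpha> A"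
    and beta_hom: "A \<in> Obj \<A> \<Longrightarrow> \<^bold>\<beta> A \<in> Hom \<A> (\<^bold>1\<langle>1\<rangle> \<otimes>\<^sub>o A) (A \<otimes>\<^sub>o \<^bold>1\<langle>1\<rangle>)"
    and beta_iso: "A \<in> Obj \<A> \<Longrightarrow> is_iso \<A> (\<^bold>\<beta> A)"
    and beta_natural: "f \<in> Hom \<A> A B
      \<Longrightarrow> \<^bold>\<beta> B \<cdot> (Id \<A> (\<^bold>1\<langle>1\<rangle>) \<otimes>\<^sub>a f) = (f \<otimes>\<^sub>a Id \<A> (\<^bold>1\<langle>1\<rangle>)) \<cdot> \<^bold>\<beta> A"
    and alpha_unit: "\<^bold>\<alpha> \<^bold>1 = \<^bold>\<lambda> (\<^bold>1\<langle>1\<rangle>)"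
    and alpha_shift: "A \<in> Obj \<A>
      \<Longrightarrow> \<^bold>\<alpha> (A\<langle>1\<rangle>) \<cdot> (\<^bold>\<alpha> A \<otimes>\<^sub>a Id \<A> (\<^bold>1\<langle>1\<rangle>)) = (\<^bold>\<alpha> A)\<lbrakk>1\<rbrakk> \<cdot> \<^bold>\<alpha> (A \<otimes>\<^sub>o \<^bold>1\<langle>1\<rangle>)"
    and beta_shift_unit: "\<^bold>\<beta> (\<^bold>1\<langle>1\<rangle>) = \<^bold>- Id \<A> (\<^bold>1\<langle>1\<rangle> \<otimes>\<^sub>o \<^bold>1\<langle>1\<rangle>)"
    and beta_tensor: "\<lbrakk>A \<in> Obj \<A>; B \<in> Obj \<A>\<rbrakk> \<Longrightarrow> \<^bold>\<beta> (A \<otimes>\<^sub>o B) =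
        (\<a> A B (\<^bold>1\<langle>1\<rangle>))\<^sup>-\<^sup>1 \<cdot> (Id \<A> A \<otimes>\<^sub>a \<^bold>\<beta> B) \<cdot> \<a> A (\<^bold>1\<langle>1\<rangle>) B \<cdot>
        (\<^bold>\<beta> A \<otimes>\<^sub>a Id \<A> B) \<cdot> (\<a> (\<^bold>1\<langle>1\<rangle>) A B)\<^sup>-\<^sup>1"
    and tensor_exact_left: "\<lbrakk>distinguished \<A> A B C f g h; D \<in> Obj \<A>\<rbrakk>
      \<Longrightarrow> distinguished \<A> (D \<otimes>\<^sub>o A) (D \<otimes>\<^sub>o B) (D \<otimes>\<^sub>o C)
            (Id \<A> D \<otimes>\<^sub>a f) (Id \<A> D \<otimes>\<^sub>a g) (tensor_shift_left \<A> D A \<cdot> (Id \<A> D \<otimes>\<^sub>a h))"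
    and tensor_exact_right: "\<lbrakk>distinguished \<A> A B C f g h; D \<in> Obj \<A>\<rbrakk>
      \<Longrightarrow> distinguished \<A> (A \<otimes>\<^sub>o D) (B \<otimes>\<^sub>o D) (C \<otimes>\<^sub>o D)
            (f \<otimes>\<^sub>a Id \<A> D) (g \<otimes>\<^sub>a Id \<A> D) (tensor_shift_right \<A> A D \<cdot> (h \<otimes>\<^sub>a Id \<A> D))"


section \<open>Complementary idempotents\<close>

text \<open>When this holds, \<open>(U, \<eta>)\<close> is a unital idempotent, \<open>(C, \<epsilon>)\<close> is a counital idempotent, and
  each is the complementary idempotent of the other.\<close>

definition complementary_idempotents ::
    "('o, 'm, 'z) triangulated_monoidal_cat_scheme \<Rightarrow> 'o \<Rightarrow> 'o \<Rightarrow> 'm \<Rightarrow> 'm \<Rightarrow> 'm \<Rightarrow> bool" where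
  "complementary_idempotents \<A> C U \<epsilon> \<eta> \<delta> \<longleftrightarrow>
     isomorphic_to_zero \<A> (C \<otimes>\<^sub>o\<^bsub>\<A>\<^esub> U) \<and> isomorphic_to_zero \<A> (U \<otimes>\<^sub>o\<^bsub>\<A>\<^esub> C) \<and>
     distinguished \<A> C \<^bold>1\<^bsub>\<A>\<^esub> U \<epsilon> \<eta> \<delta>"

end

(* The octahedral axiom for the composite of eps and epss says that T is also a cone of the composite
   of etas and eta, which gives the isomorphism and presents T by two triangles. Tensoring these
   two triangles with C, U, Cs and Us yields all the required vanishing. Applied to the inclusion of
   C into X, a direct sum of C and Us, followed by (eps, etas) from X to 1, the octahedral axiom shows
   that the cone of (eps, etas) is a cone of the composite of etas and eta, hence T; the counital case
   is dual. Finally, the vanishing of C (x) Us or of U (x) Cs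
   makes U (x) etas or C (x) epss isomorphic, as an arrow, to the map defining T, which identifies
   T with U (x) Cs or T[-1] with C (x) Us. *)

theory Submission
  imports Defs
begin

section \<open>Categories\<close>

text \<open>Cones are not functorial: a commutative square of first maps extends to the cones only
  by a non-unique map. Each identification of T with another object is therefore made by exhibiting
  an isomorphism between two arrows and comparing their cones. The two presentations of T divide the
  labour. In the unital case C annihilates U by complementarity and Us by hypothesis, hence it
  annihilates the cone of \<open>\<eta> \<cdot> \<eta>s\<close>; likewise Us annihilates Cs and C,
  hence the cone of \<open>\<epsilon>s \<cdot> \<epsilon>\<close>. In the counital case U is paired
  with the second arrow and Cs with the first. The resulting triangles must have the given direct
  sum X and the given T as vertices, whatever models were chosen, so triangles have to be
  transported along isomorphisms. On the monoidal side, the arrow comparison uses the left unitor at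
  one end and the right unitor at the other; it closes up because the two agree at the unit.\<close>

lemma HomI: "\<lbrakk>f \<in> Arr \<A>; Dom \<A> f = A; Cod \<A> f = B\<rbrakk> \<Longrightarrow> f \<in> Hom \<A> A B"
  by (simp add: Hom_def)

context category
begin

lemma hom_obj:
  assumes "f \<in> Hom \<A> A B"
  shows "A \<in> Obj \<A>" "B \<in> Obj \<A>"
  using assms dom_cod by (auto simp: Hom_def)

lemma obj_dom_cod [simp]:
  assumes "f \<in> Arr \<A>"
  shows "Dom \<A> f \<in> Obj \<A>" "Cod \<A> f \<in> Obj \<A>"
  using assms dom_cod by auto

lemma arr_id [simp]:
  assumes "A \<in> Obj \<A>"
  shows "Id \<A> A \<in> Arr \<A>" "Dom \<A> (Id \<A> A) = A" "Cod \<A> (Id \<A> A) = A"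
  using id_hom[OF assms] by (auto simp: Hom_def)

lemma arr_comp [simp]:
  assumes "f \<in> Arr \<A>" "g \<in> Arr \<A>" "Cod \<A> f = Dom \<A> g"
  shows "g \<cdot> f \<in> Arr \<A>" "Dom \<A> (g \<cdot> f) = Dom \<A> f" "Cod \<A> (g \<cdot> f) = Cod \<A> g"
  using comp_hom[of f "Dom \<A> f" "Cod \<A> f" g "Cod \<A> g"] assms by (auto simp: Hom_def)

lemma comp_id [simp]:
  assumes "f \<in> Arr \<A>"
  shows "Cod \<A> f = B \<Longrightarrow> Id \<A> B \<cdot> f = f" "Dom \<A> f = A \<Longrightarrow> f \<cdot> Id \<A> A = f"
  using id_left id_right assms by (auto simp: Hom_def)

lemma assoc [simp]:
  assumes "f \<in> Arr \<A>" "g \<in> Arr \<A>" "h \<in> Arr \<A>" "Cod \<A> f = Dom \<A> g" "Cod \<A> g = Dom \<A> h"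
  shows "(h \<cdot> g) \<cdot> f = h \<cdot> (g \<cdot> f)"
  using comp_assoc assms by (auto simp: Hom_def)

text \<open>The simplifier normalises composites to the right, so a known composite of two arrows is
  hidden by whatever precedes them. This form rewrites it in front of a tail
  \<open>e\<close>.\<close>

lemma rewrite_comp:
  assumes "g \<cdot> f = k" "f \<in> Arr \<A>" "g \<in> Arr \<A>" "Cod \<A> f = Dom \<A> g"
    "e \<in> Arr \<A>" "Cod \<A> e = Dom \<A> f"
  shows "g \<cdot> (f \<cdot> e) = k \<cdot> e"
  using assms assoc by metis

lemma is_isoI:
  assumes "f \<in> Hom \<A> A B" "g \<in> Hom \<A> B A" "g \<cdot> f = Id \<A> A" "f \<cdot> g = Id \<A> B"
  shows "is_iso \<A> f"
  using assms by (auto simp: is_iso_def inverse_arrows_def Hom_def)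

lemma is_isoE:
  assumes "is_iso \<A> f" "f \<in> Hom \<A> A B"
  obtains g where "g \<in> Hom \<A> B A" "g \<cdot> f = Id \<A> A" "f \<cdot> g = Id \<A> B" "is_iso \<A> g"
proof -
  obtain g where g: "g \<in> Hom \<A> B A" "g \<cdot> f = Id \<A> A" "f \<cdot> g = Id \<A> B"
    using assms by (auto simp: is_iso_def inverse_arrows_def Hom_def)
  with is_isoI[OF g(1) assms(2)] that show thesis by blast
qed

lemma is_iso_id: "A \<in> Obj \<A> \<Longrightarrow> is_iso \<A> (Id \<A> A)"
  by (rule is_isoI[of _ A A "Id \<A> A"]) (auto intro: id_hom)

lemma is_iso_comp:
  assumes "f \<in> Hom \<A> A B" "g \<in> Hom \<A> B D" "is_iso \<A> f" "is_iso \<A> g"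
  shows "is_iso \<A> (g \<cdot> f)"
proof -
  obtain f' where f': "f' \<in> Hom \<A> B A" "f' \<cdot> f = Id \<A> A" "f \<cdot> f' = Id \<A> B"
    using is_isoE assms by metis
  obtain g' where g': "g' \<in> Hom \<A> D B" "g' \<cdot> g = Id \<A> B" "g \<cdot> g' = Id \<A> D"
    using is_isoE assms by metis
  have "g' \<cdot> (g \<cdot> f) = f"
    using f' g' assms by (subst rewrite_comp[OF g'(2)]) (auto simp: Hom_def)
  moreover have "f \<cdot> (f' \<cdot> g') = g'"
    using f' g' assms by (subst rewrite_comp[OF f'(3)]) (auto simp: Hom_def)
  ultimately show ?thesis
    using f' g' assms by (intro is_isoI[of _ A D "f' \<cdot> g'"]) (auto simp: Hom_def)
qed

text \<open>Invertibility of \<open>g \<cdot> f\<close> gives \<open>f\<close> a left inverse and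
  that of \<open>f \<cdot> g\<close> a right inverse, and the two coincide. It serves comparison
  maps between cones, which are not mutually inverse but have invertible composites.\<close>

lemma is_iso_two_sided:
  assumes f: "f \<in> Hom \<A> A B" and g: "g \<in> Hom \<A> B A"
    and "is_iso \<A> (g \<cdot> f)" "is_iso \<A> (f \<cdot> g)"
  shows "is_iso \<A> f"
proof -
  have gf: "g \<cdot> f \<in> Hom \<A> A A" and fg: "f \<cdot> g \<in> Hom \<A> B B"
    using f g comp_hom by blast+
  obtain x where x: "x \<in> Hom \<A> A A" "x \<cdot> (g \<cdot> f) = Id \<A> A"
    using is_isoE[OF assms(3) gf] by blast
  obtain y where y: "y \<in> Hom \<A> B B" "(f \<cdot> g) \<cdot> y = Id \<A> B"
    using is_isoE[OF assms(4) fg] by blast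
  have fgy: "f \<cdot> (g \<cdot> y) = Id \<A> B"
    using y f g by (simp add: Hom_def)
  have xgf: "(x \<cdot> g) \<cdot> f = Id \<A> A"
    using x f g by (simp add: Hom_def)
  have "x \<cdot> g = (x \<cdot> g) \<cdot> (f \<cdot> (g \<cdot> y))"
    unfolding fgy using x f g by (simp add: Hom_def)
  also have "\<dots> = ((x \<cdot> g) \<cdot> f) \<cdot> (g \<cdot> y)"
    using x(1) y(1) f g by (simp add: Hom_def)
  also have "\<dots> = g \<cdot> y"
    unfolding xgf using y f g by (simp add: Hom_def)
  finally have "x \<cdot> g = g \<cdot> y" .
  with fgy xgf show ?thesis
    using is_isoI[OF f comp_hom[OF g x(1)]] by simp
qed

lemma iso_epi:
  assumes "is_iso \<A> e" "e \<in> Hom \<A> A B" "x \<in> Hom \<A> B D" "y \<in> Hom \<A> B D" "x \<cdot> e = y \<cdot> e"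
  shows "x = y"
proof -
  obtain k where k: "k \<in> Hom \<A> B A" "e \<cdot> k = Id \<A> B" using is_isoE[OF assms(1,2)] by metis
  then show ?thesis
    using comp_assoc[OF k(1) assms(2,3)] comp_assoc[OF k(1) assms(2,4)] assms id_right by metis
qed

lemma iso_mono:
  assumes "is_iso \<A> e" "e \<in> Hom \<A> B D" "x \<in> Hom \<A> A B" "y \<in> Hom \<A> A B" "e \<cdot> x = e \<cdot> y"
  shows "x = y"
proof -
  obtain k where k: "k \<in> Hom \<A> D B" "k \<cdot> e = Id \<A> B" using is_isoE[OF assms(1,2)] by metis
  then show ?thesis
    using comp_assoc[OF assms(3,2) k(1)] comp_assoc[OF assms(4,2) k(1)] assms id_left by metis
qed

lemma isomorphicI: "\<lbrakk>f \<in> Hom \<A> A B; is_iso \<A> f\<rbrakk> \<Longrightarrow> A \<simeq> B"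
  by (auto simp: isomorphic_def)

lemma isomorphic_sym: "A \<simeq> B \<Longrightarrow> B \<simeq> A"
  unfolding isomorphic_def by (meson is_isoE)

end


section \<open>Additive categories\<close>

context additive_category
begin

lemma add_hom: "\<lbrakk>f \<in> Hom \<A> A B; g \<in> Hom \<A> A B\<rbrakk> \<Longrightarrow> f \<^bold>+ g \<in> Hom \<A> A B"
  using comm_group.axioms(2)[OF hom_comm_group, of A B] group.is_monoid
    monoid.m_closed[of "hom_group \<A> A B"] hom_obj by (fastforce simp: hom_group_def)

lemma zero_hom: "\<lbrakk>A \<in> Obj \<A>; B \<in> Obj \<A>\<rbrakk> \<Longrightarrow> Zero \<A> A B \<in> Hom \<A> A B"
  using comm_group.axioms(2)[OF hom_comm_group, of A B] group.is_monoid
    monoid.one_closed[of "hom_group \<A> A B"] by (fastforce simp: hom_group_def)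

lemma neg_hom:
  assumes "f \<in> Hom \<A> A B" shows "\<^bold>- f \<in> Hom \<A> A B"
proof -
  interpret G: comm_group "hom_group \<A> A B" using hom_comm_group hom_obj assms by blast
  show ?thesis using G.inv_closed[of f] assms by (auto simp: neg_arr_def hom_group_def Hom_def)
qed

lemma add_neg:
  assumes "f \<in> Hom \<A> A B" shows "f \<^bold>+ \<^bold>- f = Zero \<A> A B"
proof -
  interpret G: comm_group "hom_group \<A> A B" using hom_comm_group hom_obj assms by blast
  show ?thesis using G.r_inv[of f] assms by (auto simp: neg_arr_def hom_group_def Hom_def)
qed

lemma add_commute:
  assumes "f \<in> Hom \<A> A B" "g \<in> Hom \<A> A B" shows "f \<^bold>+ g = g \<^bold>+ f"
proof -
  interpret G: comm_group "hom_group \<A> A B" using hom_comm_group hom_obj assms by blast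
  show ?thesis using G.m_comm[of f g] assms by (auto simp: hom_group_def)
qed

lemma add_assoc:
  assumes "f \<in> Hom \<A> A B" "g \<in> Hom \<A> A B" "h \<in> Hom \<A> A B"
  shows "(f \<^bold>+ g) \<^bold>+ h = f \<^bold>+ (g \<^bold>+ h)"
proof -
  interpret G: comm_group "hom_group \<A> A B" using hom_comm_group hom_obj assms by blast
  show ?thesis using G.m_assoc[of f g h] assms by (auto simp: hom_group_def)
qed

lemma add_zero:
  assumes "f \<in> Hom \<A> A B"
  shows "f \<^bold>+ Zero \<A> A B = f" "Zero \<A> A B \<^bold>+ f = f"
proof -
  interpret G: comm_group "hom_group \<A> A B" using hom_comm_group hom_obj assms by blast
  show "f \<^bold>+ Zero \<A> A B = f" "Zero \<A> A B \<^bold>+ f = f"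
    using G.r_one[of f] G.l_one[of f] assms by (auto simp: hom_group_def)
qed

lemma neg_unique:
  assumes "f \<in> Hom \<A> A B" "g \<in> Hom \<A> A B" "f \<^bold>+ g = Zero \<A> A B"
  shows "g = \<^bold>- f"
  using assms add_assoc[OF neg_hom[OF assms(1)] assms(1,2)] add_neg add_commute neg_hom add_zero
  by metis

lemma neg_neg: "f \<in> Hom \<A> A B \<Longrightarrow> \<^bold>- (\<^bold>- f) = f"
  using neg_unique[of "\<^bold>- f" A B f] add_neg add_commute neg_hom by metis

text \<open>Cancellation in the hom group. It is how additivity of composition and of the suspension
  is turned into preservation of zero maps.\<close>

lemma idempotent_zero:
  assumes "f \<in> Hom \<A> A B" "f \<^bold>+ f = f" shows "f = Zero \<A> A B"
proof -
  have "f = f \<^bold>+ (f \<^bold>+ \<^bold>- f)"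
    using assms by (simp add: add_neg add_zero)
  also have "\<dots> = (f \<^bold>+ f) \<^bold>+ \<^bold>- f"
    using add_assoc[OF assms(1) assms(1) neg_hom[OF assms(1)]] by simp
  finally show ?thesis using assms by (simp add: add_neg)
qed

lemma comp_zero:
  assumes "f \<in> Hom \<A> A B" "D \<in> Obj \<A>"
  shows "f \<cdot> Zero \<A> D A = Zero \<A> D B" "Zero \<A> B D \<cdot> f = Zero \<A> A D"
proof -
  note zs = zero_hom[OF assms(2) hom_obj(1)[OF assms(1)]] zero_hom[OF hom_obj(2)[OF assms(1)] assms(2)]
  show "f \<cdot> Zero \<A> D A = Zero \<A> D B"
    using idempotent_zero[OF comp_hom[OF zs(1) assms(1)]] comp_add_right[OF zs(1) zs(1) assms(1)]
      add_zero(1)[OF zs(1)] by simp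
  show "Zero \<A> B D \<cdot> f = Zero \<A> A D"
    using idempotent_zero[OF comp_hom[OF assms(1) zs(2)]] comp_add_left[OF assms(1) zs(2) zs(2)]
      add_zero(1)[OF zs(2)] by simp
qed

lemma neg_comp:
  assumes "f \<in> Hom \<A> A B" "g \<in> Hom \<A> B D"
  shows "(\<^bold>- g) \<cdot> f = \<^bold>- (g \<cdot> f)" "g \<cdot> (\<^bold>- f) = \<^bold>- (g \<cdot> f)"
proof -
  show "(\<^bold>- g) \<cdot> f = \<^bold>- (g \<cdot> f)"
    using comp_add_left[OF assms neg_hom[OF assms(2)]] assms
    by (intro neg_unique[of _ A D])
      (auto intro: comp_hom neg_hom simp: add_neg comp_zero hom_obj)
  show "g \<cdot> (\<^bold>- f) = \<^bold>- (g \<cdot> f)"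
    using comp_add_right[OF assms(1) neg_hom[OF assms(1)] assms(2)] assms
    by (intro neg_unique[of _ A D])
      (auto intro: comp_hom neg_hom simp: add_neg comp_zero hom_obj)
qed

text \<open>Every map to or from \<open>Z\<close> factors through its identity. The equational form
  lets vanishing be proved by showing that an identity factors through a zero map.\<close>

lemma zero_object_iff: "zero_object \<A> Z \<longleftrightarrow> Z \<in> Obj \<A> \<and> Id \<A> Z = Zero \<A> Z Z"
proof
  assume "zero_object \<A> Z"
  then show "Z \<in> Obj \<A> \<and> Id \<A> Z = Zero \<A> Z Z"
    unfolding zero_object_def using id_hom zero_hom by metis
next
  assume Z: "Z \<in> Obj \<A> \<and> Id \<A> Z = Zero \<A> Z Z"
  have "f = Zero \<A> A Z" if "A \<in> Obj \<A>" "f \<in> Hom \<A> A Z" for A f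
    using Z id_left[OF that(2)] comp_zero(2)[OF that(2)] by simp
  moreover have "f = Zero \<A> Z A" if "A \<in> Obj \<A>" "f \<in> Hom \<A> Z A" for A f
    using Z id_right[OF that(2)] comp_zero(1)[OF that(2)] by simp
  ultimately show "zero_object \<A> Z"
    unfolding zero_object_def using Z zero_hom by metis
qed

lemma hom_zero_object:
  assumes "zero_object \<A> Z"
  shows "f \<in> Hom \<A> A Z \<Longrightarrow> f = Zero \<A> A Z" "f \<in> Hom \<A> Z A \<Longrightarrow> f = Zero \<A> Z A"
  using assms zero_hom hom_obj unfolding zero_object_def by metis+

lemma isomorphic_to_zero_iff: "isomorphic_to_zero \<A> A \<longleftrightarrow> zero_object \<A> A"
proof
  assume "isomorphic_to_zero \<A> A"
  then obtain Z f where Z: "zero_object \<A> Z" "f \<in> Hom \<A> A Z" "is_iso \<A> f"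
    by (auto simp: isomorphic_to_zero_def isomorphic_def)
  then obtain g where g: "g \<in> Hom \<A> Z A" "g \<cdot> f = Id \<A> A" using is_isoE by metis
  have "Id \<A> A = g \<cdot> Zero \<A> A Z" using g Z hom_zero_object by metis
  then show "zero_object \<A> A"
    using comp_zero(1)[OF g(1)] hom_obj Z by (auto simp: zero_object_iff)
next
  assume "zero_object \<A> A"
  then show "isomorphic_to_zero \<A> A"
    unfolding isomorphic_to_zero_def isomorphic_def
    using is_iso_id id_hom by (auto simp: zero_object_iff)
qed

lemma is_iso_neg_id: "A \<in> Obj \<A> \<Longrightarrow> is_iso \<A> (\<^bold>- Id \<A> A)"
  using neg_comp[OF neg_hom[OF id_hom] id_hom] neg_comp[OF id_hom neg_hom[OF id_hom]]
  by (intro is_isoI[of _ A A "\<^bold>- Id \<A> A"])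
    (auto intro: id_hom neg_hom
      simp: neg_neg[OF id_hom] id_left[OF neg_hom[OF id_hom]] id_right[OF neg_hom[OF id_hom]])

text \<open>Writing \<open>e\<close> as the identity plus \<open>n\<close> with
  \<open>n \<cdot> n\<close> zero, the inverse is the identity minus \<open>n\<close>.\<close>

lemma is_iso_unipotent:
  assumes e: "e \<in> Hom \<A> A A" and sq: "(e \<^bold>+ \<^bold>- Id \<A> A) \<cdot> (e \<^bold>+ \<^bold>- Id \<A> A) = Zero \<A> A A"
  shows "is_iso \<A> e"
proof -
  define n where "n = e \<^bold>+ \<^bold>- Id \<A> A"
  have A: "A \<in> Obj \<A>" using e hom_obj by blast
  note i = id_hom[OF A]
  have n: "n \<in> Hom \<A> A A" unfolding n_def using e i add_hom neg_hom by blast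
  have m: "Id \<A> A \<^bold>+ \<^bold>- n \<in> Hom \<A> A A" using n i add_hom neg_hom by blast
  have e_eq: "e = Id \<A> A \<^bold>+ n"
  proof -
    have "Id \<A> A \<^bold>+ n = (e \<^bold>+ \<^bold>- Id \<A> A) \<^bold>+ Id \<A> A" using add_commute[OF i n] n_def by simp
    also have "\<dots> = e"
      using add_assoc[OF e neg_hom[OF i] i] add_commute[OF neg_hom[OF i] i] add_neg[OF i]
        add_zero(1)[OF e] by simp
    finally show ?thesis by simp
  qed
  have sq': "n \<cdot> n = Zero \<A> A A" using sq n_def by simp
  have nz: "\<^bold>- Zero \<A> A A = Zero \<A> A A"
    using neg_unique[of "Zero \<A> A A" A A "Zero \<A> A A"] zero_hom[OF A A] add_zero by metis
  have nn: "n \<cdot> \<^bold>- n = Zero \<A> A A" "\<^bold>- n \<cdot> n = Zero \<A> A A"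
    using neg_comp[OF n n] sq' nz by auto
  have cancel: "(Id \<A> A \<^bold>+ \<^bold>- n) \<^bold>+ n = Id \<A> A" "(Id \<A> A \<^bold>+ n) \<^bold>+ \<^bold>- n = Id \<A> A"
    using add_assoc[OF i neg_hom[OF n] n] add_assoc[OF i n neg_hom[OF n]] add_commute[OF n neg_hom[OF n]]
      add_neg[OF n] add_zero[OF i] by auto
  have "e \<cdot> (Id \<A> A \<^bold>+ \<^bold>- n) = (Id \<A> A \<^bold>+ \<^bold>- n) \<^bold>+ (n \<^bold>+ n \<cdot> \<^bold>- n)"
    using comp_add_left[OF m i n] comp_add_right[OF i neg_hom[OF n] n] e_eq id_left[OF m]
      id_right[OF n] by simp
  also have "\<dots> = Id \<A> A" using nn cancel add_zero[OF n] by simp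
  finally have 1: "e \<cdot> (Id \<A> A \<^bold>+ \<^bold>- n) = Id \<A> A" .
  have "(Id \<A> A \<^bold>+ \<^bold>- n) \<cdot> e = (Id \<A> A \<^bold>+ n) \<^bold>+ (\<^bold>- n \<^bold>+ \<^bold>- n \<cdot> n)"
    using comp_add_left[OF e i neg_hom[OF n]] comp_add_right[OF i n neg_hom[OF n]] e_eq
      id_left[OF e] id_right[OF neg_hom[OF n]] by simp
  also have "\<dots> = Id \<A> A" using nn cancel add_zero[OF neg_hom[OF n]] by simp
  finally show ?thesis using 1 is_isoI[OF e m] by blast
qed

lemma direct_sum_commute: "direct_sum \<A> X A B \<Longrightarrow> direct_sum \<A> X B A"
  unfolding direct_sum_def biproduct_def using add_commute[OF comp_hom comp_hom] by metis

end


section \<open>Triangulated categories\<close>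

context triangulated_category
begin

section \<open>The suspension as an additive, fully faithful functor\<close>

lemma shift_obj: "A \<in> Obj \<A> \<Longrightarrow> A\<langle>1\<rangle> \<in> Obj \<A>"
  using shift_bij_obj by (auto simp: bij_betw_def)

lemma shift_zero:
  assumes "A \<in> Obj \<A>" "B \<in> Obj \<A>"
  shows "(Zero \<A> A B)\<lbrakk>1\<rbrakk> = Zero \<A> (A\<langle>1\<rangle>) (B\<langle>1\<rangle>)"
  using idempotent_zero[OF shift_hom[OF zero_hom[OF assms]]] shift_add[OF zero_hom zero_hom]
    add_zero(1)[OF zero_hom] assms by metis

lemma shift_faithful:
  assumes "f \<in> Hom \<A> A B" "g \<in> Hom \<A> A B" "f\<lbrakk>1\<rbrakk> = g\<lbrakk>1\<rbrakk>"
  shows "f = g"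
  using assms shift_bij_arr by (auto simp: Hom_def bij_betw_def inj_on_def)

lemma shift_full:
  assumes "k \<in> Hom \<A> (A\<langle>1\<rangle>) (B\<langle>1\<rangle>)" "A \<in> Obj \<A>" "B \<in> Obj \<A>"
  obtains f where "f \<in> Hom \<A> A B" "f\<lbrakk>1\<rbrakk> = k"
proof -
  have "k \<in> ShiftA \<A> ` Arr \<A>"
    using assms(1) bij_betw_imp_surj_on[OF shift_bij_arr] by (simp add: Hom_def)
  then obtain f where f: "f \<in> Arr \<A>" "f\<lbrakk>1\<rbrakk> = k" by blast
  \<comment> \<open>Surjectivity on arrows does not fix the endpoints of the preimage; injectivity
    of the suspension on objects does.\<close>
  have "f\<lbrakk>1\<rbrakk> \<in> Hom \<A> ((Dom \<A> f)\<langle>1\<rangle>) ((Cod \<A> f)\<langle>1\<rangle>)"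
    using f shift_hom[of f] by (auto simp: Hom_def)
  then have "(Dom \<A> f)\<langle>1\<rangle> = A\<langle>1\<rangle>" "(Cod \<A> f)\<langle>1\<rangle> = B\<langle>1\<rangle>"
    using assms f by (auto simp: Hom_def)
  then have "Dom \<A> f = A" "Cod \<A> f = B"
    using bij_betw_imp_inj_on[OF shift_bij_obj] assms f obj_dom_cod by (meson inj_onD)+
  with f that show thesis by (auto simp: Hom_def)
qed

lemma shift_neg:
  assumes "f \<in> Hom \<A> A B" shows "(\<^bold>- f)\<lbrakk>1\<rbrakk> = \<^bold>- f\<lbrakk>1\<rbrakk>"
  using neg_unique[OF shift_hom[OF assms] shift_hom[OF neg_hom[OF assms]]]
    shift_add[OF assms neg_hom[OF assms]] add_neg[OF assms] shift_zero assms hom_obj by metis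

lemma zero_object_shift:
  assumes "A \<in> Obj \<A>"
  shows "zero_object \<A> (A\<langle>1\<rangle>) \<longleftrightarrow> zero_object \<A> A"
  using assms shift_zero[OF assms assms] shift_id[OF assms] shift_obj
    shift_faithful[OF id_hom zero_hom] by (auto simp: zero_object_iff)

lemma isomorphic_shift_cancel:
  assumes "A\<langle>1\<rangle> \<simeq> B\<langle>1\<rangle>" "A \<in> Obj \<A>" "B \<in> Obj \<A>"
  shows "A \<simeq> B"
proof -
  obtain f where f: "f \<in> Hom \<A> (A\<langle>1\<rangle>) (B\<langle>1\<rangle>)" "is_iso \<A> f"
    using assms by (auto simp: isomorphic_def)
  obtain g where g: "g \<in> Hom \<A> (B\<langle>1\<rangle>) (A\<langle>1\<rangle>)" "g \<cdot> f = Id \<A> (A\<langle>1\<rangle>)" "f \<cdot> g = Id \<A> (B\<langle>1\<rangle>)"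
    using is_isoE[OF f(2,1)] by metis
  obtain f' where f': "f' \<in> Hom \<A> A B" "f'\<lbrakk>1\<rbrakk> = f" using shift_full[OF f(1) assms(2,3)] .
  obtain g' where g': "g' \<in> Hom \<A> B A" "g'\<lbrakk>1\<rbrakk> = g" using shift_full[OF g(1) assms(3,2)] .
  have "g' \<cdot> f' = Id \<A> A" "f' \<cdot> g' = Id \<A> B"
    using shift_comp[OF f'(1) g'(1)] shift_comp[OF g'(1) f'(1)] f' g' g assms shift_id comp_hom id_hom
    by (metis shift_faithful)+
  then show ?thesis using isomorphicI[OF f'(1)] is_isoI[OF f'(1) g'(1)] by blast
qed

lemma unshift:
  assumes "A \<in> Obj \<A>"
  shows "A\<langle>-1\<rangle> \<in> Obj \<A>" "(A\<langle>-1\<rangle>)\<langle>1\<rangle> = A"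
proof -
  have "A \<in> ShiftO \<A> ` Obj \<A>" using shift_bij_obj assms by (auto simp: bij_betw_def)
  then show "A\<langle>-1\<rangle> \<in> Obj \<A>" "(A\<langle>-1\<rangle>)\<langle>1\<rangle> = A"
    unfolding UnshiftO_def by (auto intro: inv_into_into f_inv_into_f)
qed

section \<open>Weak kernels and weak cokernels in distinguished triangles\<close>

lemma distinguishedD:
  assumes "distinguished \<A> A B D f g h"
  shows "f \<in> Hom \<A> A B" "g \<in> Hom \<A> B D" "h \<in> Hom \<A> D (A\<langle>1\<rangle>)"
    "A \<in> Obj \<A>" "B \<in> Obj \<A>" "D \<in> Obj \<A>"
  using assms hom_obj by (auto simp: distinguished_def)

lemma rotate:
  assumes "distinguished \<A> A B D f g h"
  shows "distinguished \<A> B D (A\<langle>1\<rangle>) g h (\<^bold>- f\<lbrakk>1\<rbrakk>)"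
  using TR2[OF distinguishedD(1-3)[OF assms]] assms by blast

text \<open>Both composites factor through a zero object: \<open>TR3\<close> compares the triangle
  with the identity triangle of its first, respectively second, object.\<close>

lemma distinguished_comp_zero:
  assumes t: "distinguished \<A> A B D f g h"
  shows "g \<cdot> f = Zero \<A> A D" "f\<lbrakk>1\<rbrakk> \<cdot> h = Zero \<A> D (B\<langle>1\<rangle>)"
proof -
  note d = distinguishedD[OF t]
  obtain Z where Z: "zero_object \<A> Z" using ex_zero_object by blast
  obtain c where "c \<in> Hom \<A> Z D" "g \<cdot> f = c \<cdot> Zero \<A> A Z"
    using TR3[OF TR1_id[OF d(4) Z] t id_hom[OF d(4)] d(1)] by auto
  then show "g \<cdot> f = Zero \<A> A D" using comp_zero(1) d(4) by auto
  obtain e where e: "e \<in> Hom \<A> D Z" "Zero \<A> Z (B\<langle>1\<rangle>) \<cdot> e = f\<lbrakk>1\<rbrakk> \<cdot> h"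
    using TR3[OF t TR1_id[OF d(5) Z] d(1) id_hom[OF d(5)]] by auto
  then show "f\<lbrakk>1\<rbrakk> \<cdot> h = Zero \<A> D (B\<langle>1\<rangle>)" using comp_zero(2)[OF e(1) shift_obj[OF d(5)]] by simp
qed

text \<open>When \<open>x \<cdot> f\<close> vanishes, the zero map on \<open>A\<close> together with
  \<open>x\<close> maps the triangle to the triangle from a zero object to \<open>Y\<close> and on
  by the identity to \<open>Y\<close>; the third component supplied by \<open>TR3\<close> is the
  factorisation.\<close>

lemma weak_cokernel:
  assumes t: "distinguished \<A> A B D f g h" and x: "x \<in> Hom \<A> B Y" and "x \<cdot> f = Zero \<A> A Y"
  obtains y where "y \<in> Hom \<A> D Y" "x = y \<cdot> g"
proof -
  obtain Z where Z: "zero_object \<A> Z" using ex_zero_object by blast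
  have Zo: "Z \<in> Obj \<A>" and Y: "Y \<in> Obj \<A>"
    using Z x hom_obj by (auto simp: zero_object_iff)
  have Zs: "zero_object \<A> (Z\<langle>1\<rangle>)" using Z Zo zero_object_shift by blast
  have "\<^bold>- (Zero \<A> Z Y)\<lbrakk>1\<rbrakk> = Zero \<A> (Z\<langle>1\<rangle>) (Y\<langle>1\<rangle>)"
    using hom_zero_object(2)[OF Zs neg_hom[OF shift_hom[OF zero_hom[OF Zo Y]]]] .
  \<comment> \<open>\<open>TR2\<close> is read backwards from the identity triangle of
    \<open>Y\<close>, which is why its zero vertex is taken to be the suspension of
    \<open>Z\<close>.\<close>
  then have "distinguished \<A> Z Y Y (Zero \<A> Z Y) (Id \<A> Y) (Zero \<A> Y (Z\<langle>1\<rangle>))"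
    using TR2[OF zero_hom[OF Zo Y] id_hom[OF Y] zero_hom[OF Y shift_obj[OF Zo]]] TR1_id[OF Y Zs]
    by simp
  from TR3[OF t this zero_hom[OF distinguishedD(4)[OF t] Zo] x]
  obtain c where "c \<in> Hom \<A> D Y" "Id \<A> Y \<cdot> x = c \<cdot> g"
    using assms(3) comp_zero(1)[OF zero_hom[OF Zo Y]] distinguishedD(4)[OF t] by auto
  with x that show thesis by (simp add: id_left)
qed

text \<open>Dual to \<open>weak_cokernel\<close>, but \<open>TR3\<close> only fills in third
  components. Both triangles are rotated first, so that the factorisation appears suspended and is
  recovered by fullness.\<close>

lemma weak_kernel:
  assumes t: "distinguished \<A> A B D f g h" and x: "x \<in> Hom \<A> Y B" and gx: "g \<cdot> x = Zero \<A> Y D"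
  obtains y where "y \<in> Hom \<A> Y A" "x = f \<cdot> y"
proof -
  note d = distinguishedD[OF t]
  obtain Z where Z: "zero_object \<A> Z" using ex_zero_object by blast
  have Zo: "Z \<in> Obj \<A>" and Y: "Y \<in> Obj \<A>"
    using Z x hom_obj by (auto simp: zero_object_iff)
  have "Zero \<A> Z D \<cdot> Zero \<A> Y Z = g \<cdot> x"
    using gx comp_zero[OF zero_hom[OF Zo d(6)]] Y by simp
  with TR3[OF rotate[OF TR1_id[OF Y Z]] rotate[OF t] x zero_hom[OF Zo d(6)]]
  obtain c where c: "c \<in> Hom \<A> (Y\<langle>1\<rangle>) (A\<langle>1\<rangle>)" "(\<^bold>- f\<lbrakk>1\<rbrakk>) \<cdot> c = x\<lbrakk>1\<rbrakk> \<cdot> \<^bold>- (Id \<A> Y)\<lbrakk>1\<rbrakk>"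
    by auto
  obtain y where y: "y \<in> Hom \<A> Y A" "y\<lbrakk>1\<rbrakk> = c" using shift_full[OF c(1) Y d(4)] .
  have fy: "f \<cdot> y \<in> Hom \<A> Y B" using comp_hom y d by blast
  \<comment> \<open>Each rotation contributes one sign, so the signs on the two sides
    cancel.\<close>
  have "\<^bold>- (f \<cdot> y)\<lbrakk>1\<rbrakk> = \<^bold>- x\<lbrakk>1\<rbrakk>"
    using c(2) neg_comp[OF shift_hom[OF y(1)] shift_hom[OF d(1)]] shift_comp[OF y(1) d(1)] y(2)
      neg_comp[OF id_hom[OF shift_obj[OF Y]] shift_hom[OF x]] shift_id[OF Y] id_right[OF shift_hom[OF x]]
    by simp
  then have "x\<lbrakk>1\<rbrakk> = (f \<cdot> y)\<lbrakk>1\<rbrakk>"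
    using neg_neg shift_hom[OF x] shift_hom[OF fy] by metis
  with shift_faithful[OF x fy] y that show thesis by blast
qed

text \<open>Given an isomorphism of the first two terms, \<open>TR3\<close> yields maps in both directions between the
  cones. Their composites differ from the identity by a map which both factors through \<open>h\<close> and is
  annihilated by \<open>h\<close>, hence has square zero; this replaces the five lemma.\<close>

lemma cone_endo_iso:
  assumes t: "distinguished \<A> A B D f g h" and e: "e \<in> Hom \<A> D D"
    and eg: "e \<cdot> g = g" and he: "h \<cdot> e = h"
  shows "is_iso \<A> e"
proof -
  note d = distinguishedD[OF t]
  define n where "n = e \<^bold>+ \<^bold>- Id \<A> D"
  note i = id_hom[OF d(6)]
  have n: "n \<in> Hom \<A> D D" unfolding n_def using e i add_hom neg_hom by blast
  have "n \<cdot> g = Zero \<A> B D"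
    unfolding n_def using comp_add_left[OF d(2) e neg_hom[OF i]] eg neg_comp[OF d(2) i] id_left[OF d(2)]
      add_neg[OF d(2)] by simp
  then obtain m where m: "m \<in> Hom \<A> (A\<langle>1\<rangle>) D" "n = m \<cdot> h"
    using weak_cokernel[OF rotate[OF t] n] by blast
  have hn: "h \<cdot> n = Zero \<A> D (A\<langle>1\<rangle>)"
    unfolding n_def using comp_add_right[OF e neg_hom[OF i] d(3)] he neg_comp[OF i d(3)] id_right[OF d(3)]
      add_neg[OF d(3)] by simp
  have "n \<cdot> n = m \<cdot> (h \<cdot> n)"
    using comp_assoc[OF n d(3) m(1)] m(2) by simp
  then have "n \<cdot> n = Zero \<A> D D"
    using hn comp_zero(1)[OF m(1) d(6)] by simp
  then show ?thesis using is_iso_unipotent[OF e] n_def by simp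
qed

lemma cone_isomorphic:
  assumes t: "distinguished \<A> A B D f g h" and t': "distinguished \<A> A' B' D' f' g' h'"
    and a: "a \<in> Hom \<A> A A'" "is_iso \<A> a" and b: "b \<in> Hom \<A> B B'" "is_iso \<A> b"
    and sq: "f' \<cdot> a = b \<cdot> f"
  shows "D \<simeq> D'"
proof -
  note d = distinguishedD[OF t] and d' = distinguishedD[OF t']
  obtain a' where a': "a' \<in> Hom \<A> A' A" "a' \<cdot> a = Id \<A> A" "a \<cdot> a' = Id \<A> A'"
    using is_isoE[OF a(2,1)] by metis
  obtain b' where b': "b' \<in> Hom \<A> B' B" "b' \<cdot> b = Id \<A> B" "b \<cdot> b' = Id \<A> B'"
    using is_isoE[OF b(2,1)] by metis
  have "f \<cdot> a' = b' \<cdot> (b \<cdot> (f \<cdot> a'))"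
    using a' b b' d by (subst rewrite_comp[OF b'(2)]) (auto simp: Hom_def)
  also have "b \<cdot> (f \<cdot> a') = f' \<cdot> (a \<cdot> a')"
    using comp_assoc[OF a'(1) d(1) b(1)] comp_assoc[OF a'(1) a(1) d'(1)] sq by simp
  finally have sq': "f \<cdot> a' = b' \<cdot> f'" using a' id_right[OF d'(1)] by simp
  obtain c where c: "c \<in> Hom \<A> D D'" "g' \<cdot> b = c \<cdot> g" "h' \<cdot> c = a\<lbrakk>1\<rbrakk> \<cdot> h"
    using TR3[OF t t' a(1) b(1) sq] by blast
  obtain c' where c': "c' \<in> Hom \<A> D' D" "g \<cdot> b' = c' \<cdot> g'" "h \<cdot> c' = a'\<lbrakk>1\<rbrakk> \<cdot> h'"
    using TR3[OF t' t a'(1) b'(1) sq'] by blast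
  have aa: "a'\<lbrakk>1\<rbrakk> \<cdot> a\<lbrakk>1\<rbrakk> = Id \<A> (A\<langle>1\<rangle>)" "a\<lbrakk>1\<rbrakk> \<cdot> a'\<lbrakk>1\<rbrakk> = Id \<A> (A'\<langle>1\<rangle>)"
    using shift_comp[OF a(1) a'(1)] shift_comp[OF a'(1) a(1)] a' shift_id[OF d(4)] shift_id[OF d'(4)]
    by auto
  note sa = shift_hom[OF a(1)] and sa' = shift_hom[OF a'(1)]
  have "(c' \<cdot> c) \<cdot> g = g"
    using comp_assoc[OF d(2) c(1) c'(1)] c(2) comp_assoc[OF b(1) d'(2) c'(1)] c'(2)
      comp_assoc[OF b(1) b'(1) d(2)] b' id_right[OF d(2)] by metis
  moreover have "h \<cdot> (c' \<cdot> c) = h"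
    using comp_assoc[OF c(1) c'(1) d(3)] c(3) comp_assoc[OF c(1) d'(3) sa'] c'(3)
      comp_assoc[OF d(3) sa sa'] aa id_left[OF d(3)] by metis
  ultimately have 1: "is_iso \<A> (c' \<cdot> c)"
    using cone_endo_iso[OF t comp_hom[OF c(1) c'(1)]] by blast
  have "(c \<cdot> c') \<cdot> g' = g'"
    using comp_assoc[OF d'(2) c'(1) c(1)] c'(2) comp_assoc[OF b'(1) d(2) c(1)] c(2)
      comp_assoc[OF b'(1) b(1) d'(2)] b' id_right[OF d'(2)] by metis
  moreover have "h' \<cdot> (c \<cdot> c') = h'"
    using comp_assoc[OF c'(1) c(1) d'(3)] c'(3) comp_assoc[OF c'(1) d(3) sa] c(3)
      comp_assoc[OF d'(3) sa' sa] aa id_left[OF d'(3)] by metis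
  ultimately have 2: "is_iso \<A> (c \<cdot> c')"
    using cone_endo_iso[OF t' comp_hom[OF c'(1) c(1)]] by blast
  from is_iso_two_sided[OF c(1) c'(1) 1 2] c(1) show ?thesis by (rule isomorphicI[rotated])
qed

section \<open>Uniqueness of cones and detection of zero objects and isomorphisms\<close>

lemma cone_unique:
  assumes "distinguished \<A> A B D f g h" "distinguished \<A> A B D' f g' h'"
  shows "D \<simeq> D'"
  using cone_isomorphic[OF assms, of "Id \<A> A" "Id \<A> B"] distinguishedD[OF assms(1)]
  by (simp add: id_hom is_iso_id id_left id_right)

text \<open>The second map is composed with the isomorphism and the third with its inverse. This
  turns a cone known up to isomorphism into a triangle ending in the prescribed object.\<close>

lemma distinguished_replace_cone:
  assumes t: "distinguished \<A> A B D f g h" and "D \<simeq> D'"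
  obtains g' h' where "distinguished \<A> A B D' f g' h'"
proof -
  note d = distinguishedD[OF t]
  obtain c where c: "c \<in> Hom \<A> D D'" "is_iso \<A> c" using assms by (auto simp: isomorphic_def)
  obtain c' where c': "c' \<in> Hom \<A> D' D" "c' \<cdot> c = Id \<A> D" using is_isoE[OF c(2,1)] by metis
  have "distinguished \<A> A B D' f (c \<cdot> g) (h \<cdot> c')"
    by (rule TR1_iso[OF t id_hom[OF d(4)] id_hom[OF d(5)] c(1) is_iso_id[OF d(4)] is_iso_id[OF d(5)] c(2) d(1)])
      (use d c c' in \<open>auto intro: comp_hom simp: id_left id_right shift_id
        comp_assoc[OF c(1) c'(1) d(3)] id_right[OF comp_hom[OF d(2) c(1)]]\<close>)
  with that show thesis by blast
qed

text \<open>Since \<open>g\<close> lands in a zero object, the identity of \<open>B\<close> lifts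
  through \<open>f\<close>, whose source is zero. The other two cases follow by rotation.\<close>

lemma zero_second:
  assumes t: "distinguished \<A> A B D f g h" and "zero_object \<A> A" "zero_object \<A> D"
  shows "zero_object \<A> B"
proof -
  note d = distinguishedD[OF t]
  have "g \<cdot> Id \<A> B = Zero \<A> B D"
    using hom_zero_object(1)[OF assms(3) d(2)] id_right[OF d(2)] by simp
  then obtain y where y: "y \<in> Hom \<A> B A" "Id \<A> B = f \<cdot> y"
    using weak_kernel[OF t id_hom[OF d(5)]] by blast
  then show ?thesis
    using hom_zero_object(1)[OF assms(2) y(1)] comp_zero(1)[OF d(1,5)] d by (simp add: zero_object_iff)
qed

lemma zero_third:
  assumes "distinguished \<A> A B D f g h" "zero_object \<A> A" "zero_object \<A> B"
  shows "zero_object \<A> D"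
  using zero_second[OF rotate[OF assms(1)] assms(3)] zero_object_shift[OF distinguishedD(4)[OF assms(1)]]
    assms(2) by simp

lemma zero_first:
  assumes "distinguished \<A> A B D f g h" "zero_object \<A> B" "zero_object \<A> D"
  shows "zero_object \<A> A"
  using zero_third[OF rotate[OF assms(1)] assms(2,3)] zero_object_shift[OF distinguishedD(4)[OF assms(1)]]
  by simp

lemma iso_if_zero_third:
  assumes t: "distinguished \<A> A B D f g h" and Z: "zero_object \<A> D"
  shows "is_iso \<A> f"
proof -
  note d = distinguishedD[OF t]
  have "g \<cdot> Id \<A> B = Zero \<A> B D"
    using hom_zero_object(1)[OF Z d(2)] id_right[OF d(2)] by simp
  then obtain k where k: "k \<in> Hom \<A> B A" "Id \<A> B = f \<cdot> k"
    using weak_kernel[OF t id_hom[OF d(5)]] by blast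
  have As: "A\<langle>1\<rangle> \<in> Obj \<A>" using d shift_obj by blast
  have "Id \<A> (A\<langle>1\<rangle>) \<cdot> h = Zero \<A> D (A\<langle>1\<rangle>)"
    using hom_zero_object(2)[OF Z d(3)] id_left[OF d(3)] by simp
  \<comment> \<open>The weak kernel gave a right inverse. For a left inverse the triangle is rotated
    twice, so that the suspension of \<open>f\<close> (with a sign) follows \<open>h\<close>, a zero
    map through which nothing obstructs extending the identity.\<close>
  then obtain y where y: "y \<in> Hom \<A> (B\<langle>1\<rangle>) (A\<langle>1\<rangle>)" "Id \<A> (A\<langle>1\<rangle>) = y \<cdot> (\<^bold>- f\<lbrakk>1\<rbrakk>)"
    using weak_cokernel[OF rotate[OF rotate[OF t]] id_hom[OF As]] by blast
  obtain x where x: "x \<in> Hom \<A> B A" "x\<lbrakk>1\<rbrakk> = y" using shift_full[OF y(1) d(5,4)] .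
  have "(x \<cdot> (\<^bold>- f))\<lbrakk>1\<rbrakk> = (Id \<A> A)\<lbrakk>1\<rbrakk>"
    using shift_comp[OF neg_hom[OF d(1)] x(1)] shift_neg[OF d(1)] x(2) y(2) shift_id[OF d(4)] by simp
  then have "x \<cdot> (\<^bold>- f) = Id \<A> A"
    using shift_faithful[OF comp_hom[OF neg_hom[OF d(1)] x(1)] id_hom[OF d(4)]] by blast
  then have l: "(\<^bold>- x) \<cdot> f = Id \<A> A" using neg_comp[OF d(1) x(1)] by simp
  have "\<^bold>- x = ((\<^bold>- x) \<cdot> f) \<cdot> k"
    using comp_assoc[OF k(1) d(1) neg_hom[OF x(1)]] k(2) id_right[OF neg_hom[OF x(1)]] by simp
  then have "\<^bold>- x = k" using l id_left[OF k(1)] by simp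
  with l k show ?thesis using is_isoI[OF d(1) k(1)] by simp
qed

lemma iso_if_zero_first:
  assumes "distinguished \<A> A B D f g h" "zero_object \<A> A"
  shows "is_iso \<A> g"
  using iso_if_zero_third[OF rotate[OF assms(1)]] zero_object_shift[OF distinguishedD(4)[OF assms(1)]]
    assms(2) by simp

text \<open>An arbitrary cone \<open>W\<close> of the split monomorphism \<open>i\<close> is
  compared with \<open>B\<close>. Its connecting map vanishes because \<open>i\<close> has a
  retraction, and this makes the comparison \<open>c\<close> invertible.\<close>

lemma biproduct_distinguished:
  assumes bi: "biproduct \<A> X A B i j p q"
  shows "distinguished \<A> A X B i q (Zero \<A> B (A\<langle>1\<rangle>))"
proof -
  have i: "i \<in> Hom \<A> A X" and j: "j \<in> Hom \<A> B X" and p: "p \<in> Hom \<A> X A" and q: "q \<in> Hom \<A> X B"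
    and pi: "p \<cdot> i = Id \<A> A" and qj: "q \<cdot> j = Id \<A> B"
    and qi: "q \<cdot> i = Zero \<A> A B" and sum: "(i \<cdot> p) \<^bold>+ (j \<cdot> q) = Id \<A> X"
    using bi by (auto simp: biproduct_def)
  obtain W g h where t: "distinguished \<A> A X W i g h" using TR1_ex[OF i] by blast
  note d = distinguishedD[OF t]
  note A = d(4) and X = d(5) and W = d(6) and B = hom_obj(1)[OF j]
  note gi = distinguished_comp_zero(1)[OF t]
  have "p\<lbrakk>1\<rbrakk> \<cdot> (i\<lbrakk>1\<rbrakk> \<cdot> h) = h"
    using comp_assoc[OF d(3) shift_hom[OF i] shift_hom[OF p]] shift_comp[OF i p] pi shift_id[OF A]
      id_left[OF d(3)] by simp
  then have h0: "h = Zero \<A> W (A\<langle>1\<rangle>)"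
    using distinguished_comp_zero(2)[OF t] comp_zero(1)[OF shift_hom[OF p] W] by simp
  obtain c where c: "c \<in> Hom \<A> W B" "q = c \<cdot> g" using weak_cokernel[OF t q qi] .
  have gj: "g \<cdot> j \<in> Hom \<A> B W" using comp_hom[OF j d(2)] .
  have 1: "c \<cdot> (g \<cdot> j) = Id \<A> B" using comp_assoc[OF j d(2) c(1)] c(2) qj by simp
  define e where "e = (g \<cdot> j) \<cdot> c"
  have e: "e \<in> Hom \<A> W W" unfolding e_def using comp_hom[OF c(1) gj] .
  have "g = g \<cdot> ((i \<cdot> p) \<^bold>+ (j \<cdot> q))" using sum id_right[OF d(2)] by simp
  also have "\<dots> = (g \<cdot> i) \<cdot> p \<^bold>+ (g \<cdot> j) \<cdot> q"
    using comp_add_right[OF comp_hom[OF p i] comp_hom[OF q j] d(2)] comp_assoc[OF p i d(2)]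
      comp_assoc[OF q j d(2)] by simp
  also have "\<dots> = (g \<cdot> j) \<cdot> q"
    using gi comp_zero(2)[OF p W] add_zero(2)[OF comp_hom[OF q gj]] by simp
  also have "\<dots> = e \<cdot> g" using comp_assoc[OF d(2) c(1) gj] c(2) e_def by simp
  finally have eg: "e \<cdot> g = g" by simp
  \<comment> \<open>One composite of \<open>c\<close> and \<open>g \<cdot> j\<close> is an identity;
    the other, \<open>e\<close>, fixes \<open>g\<close>, and it fixes \<open>h\<close> because
    \<open>h\<close> is zero.\<close>
  have "is_iso \<A> e"
    using cone_endo_iso[OF t e eg] h0 comp_zero(2)[OF e shift_obj[OF A]] by simp
  then have "is_iso \<A> c"
    using is_iso_two_sided[OF c(1) gj] 1 is_iso_id[OF B] e_def by simp
  then show ?thesis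
    using TR1_iso[OF t id_hom[OF A] id_hom[OF X] c(1) is_iso_id[OF A] is_iso_id[OF X] _ i q
        zero_hom[OF B shift_obj[OF A]]] id_left[OF i] id_right[OF i] id_right[OF q] c(2)
      comp_zero(2)[OF c(1) shift_obj[OF A]] shift_id[OF A] h0 comp_zero(1)[OF id_hom[OF shift_obj[OF A]] W]
    by simp
qed

text \<open>In the octahedron on \<open>\<epsilon>\<close> followed by \<open>\<epsilon>s\<close>,
  the outer cones are U and Us[1]. The connecting map between them is the suspension of
  \<open>\<eta> \<cdot> \<eta>s\<close> up to sign, and rotating back removes both suspension and
  sign.\<close>

lemma cone_comp_complement:
  assumes t: "distinguished \<A> C I U \<epsilon> \<eta> \<delta>" and s: "distinguished \<A> Us I Cs \<eta>s \<epsilon>s \<delta>s"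
    and T: "distinguished \<A> C Cs T (\<epsilon>s \<cdot> \<epsilon>) w w'"
  obtains u v where "distinguished \<A> Us U T (\<eta> \<cdot> \<eta>s) u v"
proof -
  note dt = distinguishedD[OF t] and ds = distinguishedD[OF s]
  obtain k l where kl: "distinguished \<A> U T (Us\<langle>1\<rangle>) k l (\<eta>\<lbrakk>1\<rbrakk> \<cdot> \<^bold>- \<eta>s\<lbrakk>1\<rbrakk>)"
    using TR4[OF dt(1) ds(2) t rotate[OF s] T] by blast
  have eq: "\<eta>\<lbrakk>1\<rbrakk> \<cdot> \<^bold>- \<eta>s\<lbrakk>1\<rbrakk> = \<^bold>- (\<eta> \<cdot> \<eta>s)\<lbrakk>1\<rbrakk>"
    using neg_comp[OF shift_hom[OF ds(1)] shift_hom[OF dt(2)]] shift_comp[OF ds(1) dt(2)] by simp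
  have "distinguished \<A> Us U T (\<eta> \<cdot> \<eta>s) k l"
    using TR2[OF comp_hom[OF ds(1) dt(2)] distinguishedD(1,2)[OF kl]] kl eq by simp
  with that show thesis by blast
qed

lemma direct_sum_to_middle:
  assumes t: "distinguished \<A> C I U \<epsilon> \<eta> \<delta>" and s: "distinguished \<A> Us I Cs \<eta>s \<epsilon>s \<delta>s"
    and T: "distinguished \<A> Us U T (\<eta> \<cdot> \<eta>s) u u'" and X: "direct_sum \<A> X C Us"
  obtains f g h where "distinguished \<A> X I T f g h"
proof -
  note dt = distinguishedD[OF t] and ds = distinguishedD[OF s]
  obtain i j p q where bi: "biproduct \<A> X C Us i j p q" using X by (auto simp: direct_sum_def)
  then have b: "i \<in> Hom \<A> C X" "j \<in> Hom \<A> Us X" "p \<in> Hom \<A> X C" "q \<in> Hom \<A> X Us"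
    and e: "p \<cdot> i = Id \<A> C" "q \<cdot> j = Id \<A> Us" "p \<cdot> j = Zero \<A> Us C" "q \<cdot> i = Zero \<A> C Us"
    by (auto simp: biproduct_def)
  define g where "g = (\<epsilon> \<cdot> p) \<^bold>+ (\<eta>s \<cdot> q)"
  note ep = comp_hom[OF b(3) dt(1)] and eq = comp_hom[OF b(4) ds(1)]
  have g: "g \<in> Hom \<A> X I" unfolding g_def using ep eq add_hom by blast
  have gi: "g \<cdot> i = \<epsilon>"
    unfolding g_def using comp_add_left[OF b(1) ep eq] comp_assoc[OF b(1,3) dt(1)]
      comp_assoc[OF b(1,4) ds(1)] e id_right[OF dt(1)] comp_zero(1)[OF ds(1) dt(4)] add_zero(1)[OF dt(1)]
    by simp
  have gj: "g \<cdot> j = \<eta>s"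
    unfolding g_def using comp_add_left[OF b(2) ep eq] comp_assoc[OF b(2,3) dt(1)]
      comp_assoc[OF b(2,4) ds(1)] e id_right[OF ds(1)] comp_zero(1)[OF dt(1) ds(4)] add_zero(2)[OF ds(1)]
    by simp
  obtain E v v' where E: "distinguished \<A> X I E g v v'" using TR1_ex[OF g] by blast
  have t': "distinguished \<A> C I U (g \<cdot> i) \<eta> \<delta>" using t gi by simp
  \<comment> \<open>The three cones in this octahedron are Us for \<open>i\<close>, E for
    \<open>g\<close> and U for the composite \<open>\<epsilon>\<close>.\<close>
  obtain k l m where kl: "distinguished \<A> Us U E k l m" "k \<cdot> q = \<eta> \<cdot> g"
    using TR4[OF b(1) g biproduct_distinguished[OF bi] E t'] by blast
  have k: "k \<in> Hom \<A> Us U" using kl distinguishedD by blast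
  \<comment> \<open>The octahedron specifies \<open>k\<close> only after \<open>q\<close>; the
    section \<open>j\<close> of \<open>q\<close> recovers it.\<close>
  have "k = (k \<cdot> q) \<cdot> j" using comp_assoc[OF b(2,4) k] e id_right[OF k] by simp
  then have "k = \<eta> \<cdot> \<eta>s" using kl(2) comp_assoc[OF b(2) g dt(2)] gj by simp
  then have "E \<simeq> T" using cone_unique kl(1) T by blast
  with distinguished_replace_cone[OF E] that show thesis by metis
qed

lemma middle_to_direct_sum:
  assumes t: "distinguished \<A> C I U \<epsilon> \<eta> \<delta>" and s: "distinguished \<A> Us I Cs \<eta>s \<epsilon>s \<delta>s"
    and T: "distinguished \<A> C Cs T (\<epsilon>s \<cdot> \<epsilon>) w w'" and X: "direct_sum \<A> X U Cs"
  obtains f g h where "distinguished \<A> I X T f g h"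
proof -
  note dt = distinguishedD[OF t] and ds = distinguishedD[OF s]
  \<comment> \<open>The summands are swapped so that the projection \<open>p\<close> to U is the
    second map of the sum triangle; one rotation then presents Cs[1] as the cone of
    \<open>p\<close>.\<close>
  obtain j i q p where bi: "biproduct \<A> X Cs U j i q p"
    using direct_sum_commute[OF X] by (auto simp: direct_sum_def)
  then have b: "i \<in> Hom \<A> U X" "j \<in> Hom \<A> Cs X" "p \<in> Hom \<A> X U" "q \<in> Hom \<A> X Cs"
    and e: "p \<cdot> i = Id \<A> U" "q \<cdot> j = Id \<A> Cs" "p \<cdot> j = Zero \<A> Cs U" "q \<cdot> i = Zero \<A> U Cs"
    by (auto simp: biproduct_def)
  define f where "f = (i \<cdot> \<eta>) \<^bold>+ (j \<cdot> \<epsilon>s)"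
  note ie = comp_hom[OF dt(2) b(1)] and je = comp_hom[OF ds(2) b(2)]
  have f: "f \<in> Hom \<A> I X" unfolding f_def using ie je add_hom by blast
  have pf: "p \<cdot> f = \<eta>"
    unfolding f_def using comp_add_right[OF ie je b(3)] comp_assoc[OF dt(2) b(1,3)]
      comp_assoc[OF ds(2) b(2,3)] e id_left[OF dt(2)] comp_zero(2)[OF ds(2) dt(6)] add_zero(1)[OF dt(2)]
    by simp
  have qf: "q \<cdot> f = \<epsilon>s"
    unfolding f_def using comp_add_right[OF ie je b(4)] comp_assoc[OF dt(2) b(1,4)]
      comp_assoc[OF ds(2) b(2,4)] e id_left[OF ds(2)] comp_zero(2)[OF dt(2) ds(6)] add_zero(2)[OF ds(2)]
    by simp
  obtain D u u' where D: "distinguished \<A> I X D f u u'" using TR1_ex[OF f] by blast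
  have t': "distinguished \<A> I U (C\<langle>1\<rangle>) (p \<cdot> f) \<delta> (\<^bold>- \<epsilon>\<lbrakk>1\<rbrakk>)" using rotate[OF t] pf by simp
  obtain k l m where kl: "distinguished \<A> D (C\<langle>1\<rangle>) (Cs\<langle>1\<rangle>) k l m"
    "(\<^bold>- j\<lbrakk>1\<rbrakk>) \<cdot> l = f\<lbrakk>1\<rbrakk> \<cdot> (\<^bold>- \<epsilon>\<lbrakk>1\<rbrakk>)"
    using TR4[OF f b(3) D rotate[OF biproduct_distinguished[OF bi]] t'] by blast
  have l: "l \<in> Hom \<A> (C\<langle>1\<rangle>) (Cs\<langle>1\<rangle>)" using kl distinguishedD by blast
  note sj = shift_hom[OF b(2)] and sq = shift_hom[OF b(4)] and sf = shift_hom[OF f]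
    and se = shift_hom[OF dt(1)]
  have "j\<lbrakk>1\<rbrakk> \<cdot> l = f\<lbrakk>1\<rbrakk> \<cdot> \<epsilon>\<lbrakk>1\<rbrakk>"
    using kl(2) neg_comp[OF l sj] neg_comp[OF se sf] neg_neg comp_hom[OF l sj] comp_hom[OF se sf]
    by metis
  \<comment> \<open>Composing with the suspension of \<open>q\<close>, a retraction of that of
    \<open>j\<close>, isolates \<open>l\<close>.\<close>
  then have "(q \<cdot> j)\<lbrakk>1\<rbrakk> \<cdot> l = (q \<cdot> f)\<lbrakk>1\<rbrakk> \<cdot> \<epsilon>\<lbrakk>1\<rbrakk>"
    using comp_assoc[OF l sj sq] comp_assoc[OF se sf sq] shift_comp[OF b(2,4)] shift_comp[OF f b(4)]
    by simp
  then have l_eq: "l = (\<epsilon>s \<cdot> \<epsilon>)\<lbrakk>1\<rbrakk>"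
    using e qf shift_id[OF ds(6)] id_left[OF l] shift_comp[OF dt(1) ds(2)] by simp
  \<comment> \<open>Three rotations of the triangle on T give first map minus \<open>l\<close>,
    against \<open>l\<close> in the rotated octahedral triangle. The negated identity on C[1]
    absorbs the sign, and only the suspensions of \<open>D\<close> and \<open>T\<close> are
    compared.\<close>
  note r = rotate[OF rotate[OF rotate[OF T]]] and C1 = shift_obj[OF dt(4)] and Cs1 = shift_obj[OF ds(6)]
  have "D\<langle>1\<rangle> \<simeq> T\<langle>1\<rangle>"
    using cone_isomorphic[OF rotate[OF kl(1)] r neg_hom[OF id_hom[OF C1]] is_iso_neg_id[OF C1]
        id_hom[OF Cs1] is_iso_id[OF Cs1]] l_eq neg_comp[OF neg_hom[OF id_hom[OF C1]] l]
      neg_comp[OF id_hom[OF C1] l] neg_neg[OF l] id_left[OF l] id_right[OF l]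
    by simp
  then have "D \<simeq> T"
    using isomorphic_shift_cancel distinguishedD(6)[OF D] distinguishedD(6)[OF T] by blast
  with distinguished_replace_cone[OF D] that show thesis by metis
qed

text \<open>The desuspended connecting map enters with a minus sign, which cancels the one
  introduced by \<open>TR2\<close>.\<close>

lemma rotate_back:
  assumes t: "distinguished \<A> A B D f g h"
  obtains e where "distinguished \<A> (D\<langle>-1\<rangle>) A B e f g"
proof -
  note d = distinguishedD[OF t] and u = unshift[OF distinguishedD(6)[OF t]]
  obtain e where e: "e \<in> Hom \<A> (D\<langle>-1\<rangle>) A" "e\<lbrakk>1\<rbrakk> = h"
    using shift_full[of h "D\<langle>-1\<rangle>" A] d u by auto
  have "distinguished \<A> (D\<langle>-1\<rangle>) A B (\<^bold>- e) f g"
    using TR2[OF neg_hom[OF e(1)] d(1), of g] u d(2) t shift_neg[OF e(1)] e(2) neg_neg[OF d(3)] by simp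
  with that show thesis by blast
qed

end


section \<open>Monoidal categories\<close>

context monoidal_category
begin

declare tensor_obj [simp] unit_obj [simp]

lemma arr_tensor [simp]:
  assumes "f \<in> Arr \<A>" "g \<in> Arr \<A>"
  shows "f \<otimes>\<^sub>a g \<in> Arr \<A>" "Dom \<A> (f \<otimes>\<^sub>a g) = Dom \<A> f \<otimes>\<^sub>o Dom \<A> g"
    "Cod \<A> (f \<otimes>\<^sub>a g) = Cod \<A> f \<otimes>\<^sub>o Cod \<A> g"
  using tensor_hom[of f "Dom \<A> f" "Cod \<A> f" g "Dom \<A> g" "Cod \<A> g"] assms
  by (auto simp: Hom_def)

lemma arr_unitor [simp]:
  assumes "A \<in> Obj \<A>"
  shows "\<^bold>\<lambda> A \<in> Arr \<A>" "Dom \<A> (\<^bold>\<lambda> A) = \<^bold>1 \<otimes>\<^sub>o A" "Cod \<A> (\<^bold>\<lambda> A) = A"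
    "\<^bold>\<rho> A \<in> Arr \<A>" "Dom \<A> (\<^bold>\<rho> A) = A \<otimes>\<^sub>o \<^bold>1" "Cod \<A> (\<^bold>\<rho> A) = A"
  using lunit_hom[OF assms] runit_hom[OF assms] by (auto simp: Hom_def)

lemma arr_assoc [simp]:
  assumes "A \<in> Obj \<A>" "B \<in> Obj \<A>" "D \<in> Obj \<A>"
  shows "\<a> A B D \<in> Arr \<A>" "Dom \<A> (\<a> A B D) = A \<otimes>\<^sub>o B \<otimes>\<^sub>o D"
    "Cod \<A> (\<a> A B D) = A \<otimes>\<^sub>o (B \<otimes>\<^sub>o D)"
  using assoc_hom[OF assms] by (auto simp: Hom_def)

lemma interchange:
  assumes "f \<in> Arr \<A>" "g \<in> Arr \<A>" "Cod \<A> f = Dom \<A> g"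
    "f' \<in> Arr \<A>" "g' \<in> Arr \<A>" "Cod \<A> f' = Dom \<A> g'"
  shows "(g \<otimes>\<^sub>a g') \<cdot> (f \<otimes>\<^sub>a f') = (g \<cdot> f) \<otimes>\<^sub>a (g' \<cdot> f')"
  using tensor_comp[of f _ _ g _ f' _ _ g'] assms by (auto simp: Hom_def)

text \<open>By naturality the unitors identify tensoring an arrow with the unit with the arrow
  itself, and an invertible unitor can be cancelled.\<close>

lemma tensor_unit_faithful:
  assumes "f \<in> Hom \<A> A B" "g \<in> Hom \<A> A B"
  shows "Id \<A> \<^bold>1 \<otimes>\<^sub>a f = Id \<A> \<^bold>1 \<otimes>\<^sub>a g \<Longrightarrow> f = g"
    and "f \<otimes>\<^sub>a Id \<A> \<^bold>1 = g \<otimes>\<^sub>a Id \<A> \<^bold>1 \<Longrightarrow> f = g"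
proof -
  note A = hom_obj(1)[OF assms(1)]
  show "f = g" if "Id \<A> \<^bold>1 \<otimes>\<^sub>a f = Id \<A> \<^bold>1 \<otimes>\<^sub>a g"
    by (rule iso_epi[OF lunit_iso[OF A] lunit_hom[OF A] assms])
      (metis that lunit_natural assms)
  show "f = g" if "f \<otimes>\<^sub>a Id \<A> \<^bold>1 = g \<otimes>\<^sub>a Id \<A> \<^bold>1"
    by (rule iso_epi[OF runit_iso[OF A] runit_hom[OF A] assms])
      (metis that runit_natural assms)
qed

lemma is_iso_tensor:
  assumes "is_iso \<A> f" "f \<in> Hom \<A> A B" "is_iso \<A> g" "g \<in> Hom \<A> A' B'"
  shows "is_iso \<A> (f \<otimes>\<^sub>a g)"
proof -
  obtain f' where f': "f' \<in> Hom \<A> B A" "f' \<cdot> f = Id \<A> A" "f \<cdot> f' = Id \<A> B"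
    using is_isoE[OF assms(1,2)] by metis
  obtain g' where g': "g' \<in> Hom \<A> B' A'" "g' \<cdot> g = Id \<A> A'" "g \<cdot> g' = Id \<A> B'"
    using is_isoE[OF assms(3,4)] by metis
  show ?thesis
    using tensor_hom[OF assms(2,4)] tensor_hom[OF f'(1) g'(1)]
  proof (rule is_isoI)
    show "(f' \<otimes>\<^sub>a g') \<cdot> (f \<otimes>\<^sub>a g) = Id \<A> (A \<otimes>\<^sub>o A')"
      using tensor_comp[OF assms(2) f'(1) assms(4) g'(1)] f' g' tensor_id hom_obj assms by metis
    show "(f \<otimes>\<^sub>a g) \<cdot> (f' \<otimes>\<^sub>a g') = Id \<A> (B \<otimes>\<^sub>o B')"
      using tensor_comp[OF f'(1) assms(2) g'(1) assms(4)] f' g' tensor_id hom_obj assms by metis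
  qed
qed

text \<open>Kelly's argument: \<open>\<lambda>\<^sub>1 = \<rho>\<^sub>1\<close> is not an axiom but follows from the pentagon and the triangle.\<close>

lemma lunit_tensor:
  assumes A: "A \<in> Obj \<A>" and B: "B \<in> Obj \<A>"
  shows "\<^bold>\<lambda> (A \<otimes>\<^sub>o B) \<cdot> \<a> \<^bold>1 A B = \<^bold>\<lambda> A \<otimes>\<^sub>a Id \<A> B"
proof -
  let ?I = "Id \<A> \<^bold>1"
  let ?a1 = "\<a> \<^bold>1 \<^bold>1 A \<otimes>\<^sub>a Id \<A> B" and ?a2 = "\<a> \<^bold>1 (\<^bold>1 \<otimes>\<^sub>o A) B"
  let ?l = "\<^bold>\<lambda> (A \<otimes>\<^sub>o B) \<cdot> \<a> \<^bold>1 A B" and ?r = "\<^bold>\<lambda> A \<otimes>\<^sub>a Id \<A> B"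
  note [simp] = A B
  \<comment> \<open>Tensoring with the unit and precomposing with two associators puts both sides in
    a form where the pentagon and the triangle apply; both operations are undone at the end.\<close>
  have "(?I \<otimes>\<^sub>a ?l) \<cdot> (?a2 \<cdot> ?a1) = (?I \<otimes>\<^sub>a \<^bold>\<lambda> (A \<otimes>\<^sub>o B)) \<cdot> ((?I \<otimes>\<^sub>a \<a> \<^bold>1 A B) \<cdot> (?a2 \<cdot> ?a1))"
    by (subst assoc[symmetric]) (simp_all add: interchange)
  also have "\<dots> = (?I \<otimes>\<^sub>a \<^bold>\<lambda> (A \<otimes>\<^sub>o B)) \<cdot> (\<a> \<^bold>1 \<^bold>1 (A \<otimes>\<^sub>o B) \<cdot> \<a> (\<^bold>1 \<otimes>\<^sub>o \<^bold>1) A B)"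
    by (simp add: pentagon)
  also have "\<dots> = (\<^bold>\<rho> \<^bold>1 \<otimes>\<^sub>a Id \<A> (A \<otimes>\<^sub>o B)) \<cdot> \<a> (\<^bold>1 \<otimes>\<^sub>o \<^bold>1) A B"
    by (subst assoc[symmetric]) (simp_all add: triangle)
  also have "\<dots> = \<a> \<^bold>1 A B \<cdot> ((\<^bold>\<rho> \<^bold>1 \<otimes>\<^sub>a Id \<A> A) \<otimes>\<^sub>a Id \<A> B)"
    using assoc_natural[OF runit_hom[OF unit_obj] id_hom[OF A] id_hom[OF B]] by (simp add: tensor_id)
  also have "\<dots> = \<a> \<^bold>1 A B \<cdot> (((?I \<otimes>\<^sub>a \<^bold>\<lambda> A) \<otimes>\<^sub>a Id \<A> B) \<cdot> ?a1)"
    by (simp add: interchange triangle)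
  also have "\<dots> = (?I \<otimes>\<^sub>a ?r) \<cdot> (?a2 \<cdot> ?a1)"
    using assoc_natural[OF id_hom[OF unit_obj] lunit_hom[OF A] id_hom[OF B]]
    by (subst assoc[symmetric]) simp_all
  finally have eq: "(?I \<otimes>\<^sub>a ?l) \<cdot> (?a2 \<cdot> ?a1) = (?I \<otimes>\<^sub>a ?r) \<cdot> (?a2 \<cdot> ?a1)" .
  have a1: "?a1 \<in> Hom \<A> (\<^bold>1 \<otimes>\<^sub>o \<^bold>1 \<otimes>\<^sub>o A \<otimes>\<^sub>o B) (\<^bold>1 \<otimes>\<^sub>o (\<^bold>1 \<otimes>\<^sub>o A) \<otimes>\<^sub>o B)" "is_iso \<A> ?a1"
    using is_iso_tensor[OF assoc_iso assoc_hom is_iso_id id_hom] by (auto intro: HomI)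
  have a2: "?a2 \<in> Hom \<A> (\<^bold>1 \<otimes>\<^sub>o (\<^bold>1 \<otimes>\<^sub>o A) \<otimes>\<^sub>o B) (\<^bold>1 \<otimes>\<^sub>o (\<^bold>1 \<otimes>\<^sub>o A \<otimes>\<^sub>o B))" "is_iso \<A> ?a2"
    by (auto intro: assoc_hom assoc_iso)
  have "?I \<otimes>\<^sub>a ?l = ?I \<otimes>\<^sub>a ?r"
    by (rule iso_epi[OF is_iso_comp[OF a1(1) a2(1) a1(2) a2(2)] comp_hom[OF a1(1) a2(1)] _ _ eq])
      (auto intro!: HomI)
  then show ?thesis
    by (rule tensor_unit_faithful(1)[rotated 2]) (auto intro!: HomI)
qed

lemma lunit_eq_runit: "\<^bold>\<lambda> \<^bold>1 = \<^bold>\<rho> \<^bold>1"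
proof -
  have "\<^bold>\<lambda> \<^bold>1 \<cdot> (Id \<A> \<^bold>1 \<otimes>\<^sub>a \<^bold>\<lambda> \<^bold>1) = \<^bold>\<lambda> \<^bold>1 \<cdot> \<^bold>\<lambda> (\<^bold>1 \<otimes>\<^sub>o \<^bold>1)"
    using lunit_natural[OF lunit_hom[OF unit_obj]] .
  \<comment> \<open>Naturality at the unitor itself, with an invertible unitor cancelled, allows
    \<open>lunit_tensor\<close> to be compared with the triangle axiom.\<close>
  then have "Id \<A> \<^bold>1 \<otimes>\<^sub>a \<^bold>\<lambda> \<^bold>1 = \<^bold>\<lambda> (\<^bold>1 \<otimes>\<^sub>o \<^bold>1)"
    by (rule iso_mono[OF lunit_iso[OF unit_obj] lunit_hom[OF unit_obj], rotated 2])
      (auto intro!: HomI)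
  then have "\<^bold>\<lambda> \<^bold>1 \<otimes>\<^sub>a Id \<A> \<^bold>1 = \<^bold>\<rho> \<^bold>1 \<otimes>\<^sub>a Id \<A> \<^bold>1"
    using lunit_tensor[OF unit_obj unit_obj] triangle[OF unit_obj unit_obj] by simp
  then show ?thesis
    by (rule tensor_unit_faithful(2)[rotated 2]) (auto intro!: HomI)
qed

text \<open>By interchange the two arrows act in the other order, meeting at the tensor square of
  the unit. There the left and right unitors agree, so one naturality square can be glued to the
  other.\<close>

lemma tensor_through_unit:
  assumes x: "x \<in> Hom \<A> A \<^bold>1" and y: "y \<in> Hom \<A> \<^bold>1 B"
  shows "\<^bold>\<rho> B \<cdot> ((Id \<A> B \<otimes>\<^sub>a x) \<cdot> (y \<otimes>\<^sub>a Id \<A> A)) = (y \<cdot> x) \<cdot> \<^bold>\<lambda> A"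
    and "\<^bold>\<lambda> B \<cdot> ((x \<otimes>\<^sub>a Id \<A> B) \<cdot> (Id \<A> A \<otimes>\<^sub>a y)) = (y \<cdot> x) \<cdot> \<^bold>\<rho> A"
proof -
  have a [simp]: "x \<in> Arr \<A>" "Dom \<A> x = A" "Cod \<A> x = \<^bold>1" "y \<in> Arr \<A>" "Dom \<A> y = \<^bold>1" "Cod \<A> y = B"
    "A \<in> Obj \<A>" "B \<in> Obj \<A>"
    using x y hom_obj by (auto simp: Hom_def)
  have "\<^bold>\<rho> B \<cdot> ((Id \<A> B \<otimes>\<^sub>a x) \<cdot> (y \<otimes>\<^sub>a Id \<A> A)) = \<^bold>\<rho> B \<cdot> ((y \<otimes>\<^sub>a Id \<A> \<^bold>1) \<cdot> (Id \<A> \<^bold>1 \<otimes>\<^sub>a x))"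
    by (simp add: interchange)
  also have "\<dots> = y \<cdot> (\<^bold>\<lambda> \<^bold>1 \<cdot> (Id \<A> \<^bold>1 \<otimes>\<^sub>a x))"
    using runit_natural[OF y] by (subst assoc[symmetric]) (simp_all add: lunit_eq_runit)
  also have "\<dots> = (y \<cdot> x) \<cdot> \<^bold>\<lambda> A"
    using lunit_natural[OF x] by simp
  finally show "\<^bold>\<rho> B \<cdot> ((Id \<A> B \<otimes>\<^sub>a x) \<cdot> (y \<otimes>\<^sub>a Id \<A> A)) = (y \<cdot> x) \<cdot> \<^bold>\<lambda> A" .
  have "\<^bold>\<lambda> B \<cdot> ((x \<otimes>\<^sub>a Id \<A> B) \<cdot> (Id \<A> A \<otimes>\<^sub>a y)) = \<^bold>\<lambda> B \<cdot> ((Id \<A> \<^bold>1 \<otimes>\<^sub>a y) \<cdot> (x \<otimes>\<^sub>a Id \<A> \<^bold>1))"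
    by (simp add: interchange)
  also have "\<dots> = y \<cdot> (\<^bold>\<rho> \<^bold>1 \<cdot> (x \<otimes>\<^sub>a Id \<A> \<^bold>1))"
    using lunit_natural[OF y] by (subst assoc[symmetric]) (simp_all add: lunit_eq_runit[symmetric])
  also have "\<dots> = (y \<cdot> x) \<cdot> \<^bold>\<rho> A"
    using runit_natural[OF x] by simp
  finally show "\<^bold>\<lambda> B \<cdot> ((x \<otimes>\<^sub>a Id \<A> B) \<cdot> (Id \<A> A \<otimes>\<^sub>a y)) = (y \<cdot> x) \<cdot> \<^bold>\<rho> A" .
qed

end


section \<open>Complementary idempotents\<close>

context triangulated_monoidal_category
begin

section \<open>Vanishing of tensor products and the tensor description of T\<close>

lemma zero_tensor_left:
  assumes "distinguished \<A> A B D f g h" "E \<in> Obj \<A>"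
  shows "\<lbrakk>zero_object \<A> (E \<otimes>\<^sub>o A); zero_object \<A> (E \<otimes>\<^sub>o B)\<rbrakk> \<Longrightarrow> zero_object \<A> (E \<otimes>\<^sub>o D)"
    and "\<lbrakk>zero_object \<A> (E \<otimes>\<^sub>o A); zero_object \<A> (E \<otimes>\<^sub>o D)\<rbrakk> \<Longrightarrow> zero_object \<A> (E \<otimes>\<^sub>o B)"
    and "\<lbrakk>zero_object \<A> (E \<otimes>\<^sub>o B); zero_object \<A> (E \<otimes>\<^sub>o D)\<rbrakk> \<Longrightarrow> zero_object \<A> (E \<otimes>\<^sub>o A)"
  using tensor_exact_left[OF assms] zero_third zero_second zero_first by metis+

lemma zero_tensor_right:
  assumes "distinguished \<A> A B D f g h" "E \<in> Obj \<A>"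
  shows "\<lbrakk>zero_object \<A> (A \<otimes>\<^sub>o E); zero_object \<A> (B \<otimes>\<^sub>o E)\<rbrakk> \<Longrightarrow> zero_object \<A> (D \<otimes>\<^sub>o E)"
    and "\<lbrakk>zero_object \<A> (A \<otimes>\<^sub>o E); zero_object \<A> (D \<otimes>\<^sub>o E)\<rbrakk> \<Longrightarrow> zero_object \<A> (B \<otimes>\<^sub>o E)"
    and "\<lbrakk>zero_object \<A> (B \<otimes>\<^sub>o E); zero_object \<A> (D \<otimes>\<^sub>o E)\<rbrakk> \<Longrightarrow> zero_object \<A> (A \<otimes>\<^sub>o E)"
  using tensor_exact_right[OF assms] zero_third zero_second zero_first by metis+

lemma zero_tensor_direct_sum:
  assumes "direct_sum \<A> X A B" "E \<in> Obj \<A>"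
  shows "\<lbrakk>zero_object \<A> (E \<otimes>\<^sub>o A); zero_object \<A> (E \<otimes>\<^sub>o B)\<rbrakk> \<Longrightarrow> zero_object \<A> (E \<otimes>\<^sub>o X)"
    and "\<lbrakk>zero_object \<A> (A \<otimes>\<^sub>o E); zero_object \<A> (B \<otimes>\<^sub>o E)\<rbrakk> \<Longrightarrow> zero_object \<A> (X \<otimes>\<^sub>o E)"
proof -
  obtain i q z where "distinguished \<A> A X B i q z"
    using assms(1) biproduct_distinguished unfolding direct_sum_def by blast
  then show "\<lbrakk>zero_object \<A> (E \<otimes>\<^sub>o A); zero_object \<A> (E \<otimes>\<^sub>o B)\<rbrakk> \<Longrightarrow> zero_object \<A> (E \<otimes>\<^sub>o X)"
    and "\<lbrakk>zero_object \<A> (A \<otimes>\<^sub>o E); zero_object \<A> (B \<otimes>\<^sub>o E)\<rbrakk> \<Longrightarrow> zero_object \<A> (X \<otimes>\<^sub>o E)"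
    using zero_tensor_left(2) zero_tensor_right(2) assms(2) by blast+
qed

lemma complementary_idempotentsD:
  assumes "complementary_idempotents \<A> C U \<epsilon> \<eta> \<delta>"
  shows "zero_object \<A> (C \<otimes>\<^sub>o U)" "zero_object \<A> (U \<otimes>\<^sub>o C)" "distinguished \<A> C \<^bold>1 U \<epsilon> \<eta> \<delta>"
  using assms by (auto simp: complementary_idempotents_def isomorphic_to_zero_iff)

text \<open>Tensoring the triangle of C and U with Us on the right has first term zero, so
  \<open>\<eta>\<close> tensored with Us is invertible. Following it by U tensored with
  \<open>\<eta>s\<close> gives \<open>\<eta> \<cdot> \<eta>s\<close> up to unitors.\<close>

lemma cone_isomorphic_tensor_unital:
  assumes t: "distinguished \<A> C \<^bold>1 U \<epsilon> \<eta> \<delta>" and s: "distinguished \<A> Us \<^bold>1 Cs \<eta>s \<epsilon>s \<delta>s"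
    and T: "distinguished \<A> Us U T (\<eta> \<cdot> \<eta>s) w w'" and zero: "zero_object \<A> (C \<otimes>\<^sub>o Us)"
  shows "T \<simeq> U \<otimes>\<^sub>o Cs"
proof -
  note dt = distinguishedD[OF t] and ds = distinguishedD[OF s]
  note e = tensor_exact_right[OF t ds(4)]
  let ?n = "\<eta> \<otimes>\<^sub>a Id \<A> Us"
  have n: "is_iso \<A> ?n" "?n \<in> Hom \<A> (\<^bold>1 \<otimes>\<^sub>o Us) (U \<otimes>\<^sub>o Us)"
    using iso_if_zero_first[OF e zero] distinguishedD(2)[OF e] by auto
  obtain l where l: "l \<in> Hom \<A> Us (\<^bold>1 \<otimes>\<^sub>o Us)" "\<^bold>\<lambda> Us \<cdot> l = Id \<A> Us" "is_iso \<A> l"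
    using is_isoE[OF lunit_iso[OF ds(4)] lunit_hom[OF ds(4)]] by metis
  obtain r where r: "r \<in> Hom \<A> U (U \<otimes>\<^sub>o \<^bold>1)" "r \<cdot> \<^bold>\<rho> U = Id \<A> (U \<otimes>\<^sub>o \<^bold>1)" "is_iso \<A> r"
    using is_isoE[OF runit_iso[OF dt(6)] runit_hom[OF dt(6)]] by metis
  note e' = tensor_exact_left[OF s dt(6)]
  let ?m = "Id \<A> U \<otimes>\<^sub>a \<eta>s"
  note m = distinguishedD(1)[OF e'] and mn = comp_hom[OF n(2) distinguishedD(1)[OF e']]
  have "?m \<cdot> ?n = (r \<cdot> \<^bold>\<rho> U) \<cdot> (?m \<cdot> ?n)" using r(2) id_left[OF mn] by simp
  also have "\<dots> = r \<cdot> ((\<eta> \<cdot> \<eta>s) \<cdot> \<^bold>\<lambda> Us)"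
    using comp_assoc[OF mn runit_hom[OF dt(6)] r(1)] tensor_through_unit(1)[OF ds(1) dt(2)] by simp
  finally have mn_eq: "?m \<cdot> ?n = r \<cdot> ((\<eta> \<cdot> \<eta>s) \<cdot> \<^bold>\<lambda> Us)" .
  note nn = comp_hom[OF ds(1) dt(2)] and lu = lunit_hom[OF ds(4)]
  have "?m \<cdot> (?n \<cdot> l) = (?m \<cdot> ?n) \<cdot> l" using comp_assoc[OF l(1) n(2) m] by simp
  also have "\<dots> = r \<cdot> (((\<eta> \<cdot> \<eta>s) \<cdot> \<^bold>\<lambda> Us) \<cdot> l)"
    using mn_eq comp_assoc[OF l(1) comp_hom[OF lu nn] r(1)] by simp
  also have "\<dots> = r \<cdot> (\<eta> \<cdot> \<eta>s)"
    using comp_assoc[OF l(1) lu nn] l(2) id_right[OF nn] by simp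
  finally show ?thesis
    using cone_isomorphic[OF T e' comp_hom[OF l(1) n(2)] is_iso_comp[OF l(1) n(2) l(3) n(1)] r(1,3)]
    by blast
qed

text \<open>Here the third term of the triangle tensored with Cs vanishes, so
  \<open>\<epsilon>\<close> tensored with Cs is invertible. The cone of C tensored with
  \<open>\<epsilon>s\<close> is a suspension, whence the shift in the conclusion.\<close>

lemma cone_isomorphic_tensor_counital:
  assumes t: "distinguished \<A> C \<^bold>1 U \<epsilon> \<eta> \<delta>" and s: "distinguished \<A> Us \<^bold>1 Cs \<eta>s \<epsilon>s \<delta>s"
    and T: "distinguished \<A> C Cs T (\<epsilon>s \<cdot> \<epsilon>) w w'" and zero: "zero_object \<A> (U \<otimes>\<^sub>o Cs)"
  shows "T\<langle>-1\<rangle> \<simeq> C \<otimes>\<^sub>o Us"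
proof -
  note dt = distinguishedD[OF t] and ds = distinguishedD[OF s]
  note e = tensor_exact_right[OF t ds(6)]
  let ?n = "\<epsilon> \<otimes>\<^sub>a Id \<A> Cs"
  have n: "is_iso \<A> ?n" "?n \<in> Hom \<A> (C \<otimes>\<^sub>o Cs) (\<^bold>1 \<otimes>\<^sub>o Cs)"
    using iso_if_zero_third[OF e zero] distinguishedD(1)[OF e] by auto
  note e' = tensor_exact_left[OF s dt(4)]
  let ?m = "Id \<A> C \<otimes>\<^sub>a \<epsilon>s"
  note lu = lunit_hom[OF ds(6)]
  have "(\<epsilon>s \<cdot> \<epsilon>) \<cdot> \<^bold>\<rho> C = (\<^bold>\<lambda> Cs \<cdot> ?n) \<cdot> ?m"
    using tensor_through_unit(2)[OF dt(1) ds(2)] comp_assoc[OF distinguishedD(2)[OF e'] n(2) lu]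
    by simp
  then have "(C \<otimes>\<^sub>o Us)\<langle>1\<rangle> \<simeq> T"
    using cone_isomorphic[OF rotate[OF e'] T runit_hom[OF dt(4)] runit_iso[OF dt(4)]
        comp_hom[OF n(2) lu] is_iso_comp[OF n(2) lu n(1) lunit_iso[OF ds(6)]]] by blast
  then have "(T\<langle>-1\<rangle>)\<langle>1\<rangle> \<simeq> (C \<otimes>\<^sub>o Us)\<langle>1\<rangle>"
    using isomorphic_sym unshift(2)[OF distinguishedD(6)[OF T]] by simp
  then show ?thesis
    using isomorphic_shift_cancel unshift(1)[OF distinguishedD(6)[OF T]] distinguishedD(4)[OF e'] by blast
qed

end

theorem theorem1p12:
  fixes \<A> :: "('o, 'm, 'z) triangulated_monoidal_cat_scheme" (structure)
    and C U Cs Us T T' :: 'o and \<epsilon> \<eta> \<delta> \<epsilon>s \<eta>s \<delta>s :: 'm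
  assumes "triangulated_monoidal_category \<A>"
    and "complementary_idempotents \<A> C U \<epsilon> \<eta> \<delta>"
    and "complementary_idempotents \<A> Us Cs \<eta>s \<epsilon>s \<delta>s"
    and "cone \<A> (\<epsilon>s \<cdot> \<epsilon>) T"
    and "cone \<A> (\<eta> \<cdot> \<eta>s) T'"
  shows "T \<simeq> T' \<and>
    (isomorphic_to_zero \<A> (C \<otimes>\<^sub>o Us) \<and> isomorphic_to_zero \<A> (Us \<otimes>\<^sub>o C) \<longrightarrow>
      T \<simeq> U \<otimes>\<^sub>o Cs \<and>
      (\<forall>X. direct_sum \<A> X C Us \<longrightarrow>
        (\<exists>\<epsilon>' \<eta>' \<delta>'. complementary_idempotents \<A> X T \<epsilon>' \<eta>' \<delta>'))) \<and>
    (isomorphic_to_zero \<A> (U \<otimes>\<^sub>o Cs) \<and> isomorphic_to_zero \<A> (Cs \<otimes>\<^sub>o U) \<longrightarrow>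
      T\<langle>-1\<rangle> \<simeq> C \<otimes>\<^sub>o Us \<and>
      (\<forall>X. direct_sum \<A> X U Cs \<longrightarrow>
        (\<exists>\<epsilon>' \<eta>' \<delta>'. complementary_idempotents \<A> (T\<langle>-1\<rangle>) X \<epsilon>' \<eta>' \<delta>')))"
proof -
  interpret triangulated_monoidal_category \<A> by fact
  note c = complementary_idempotentsD[OF assms(2)] and cs = complementary_idempotentsD[OF assms(3)]
  note t = c(3) and s = cs(3)
  note dt = distinguishedD[OF t] and ds = distinguishedD[OF s]
  obtain w w' where T: "distinguished \<A> C Cs T (\<epsilon>s \<cdot> \<epsilon>) w w'"
    using assms(4) comp_hom[OF dt(1) ds(2)] by (auto simp: cone_def Hom_def)
  obtain v v' where "distinguished \<A> Us U T' (\<eta> \<cdot> \<eta>s) v v'"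
    using assms(5) comp_hom[OF ds(1) dt(2)] by (auto simp: cone_def Hom_def)
  moreover obtain u u' where T': "distinguished \<A> Us U T (\<eta> \<cdot> \<eta>s) u u'"
    using cone_comp_complement[OF t s T] .
  ultimately have "T \<simeq> T'" using cone_unique by blast
  moreover have "T \<simeq> U \<otimes>\<^sub>o Cs \<and>
      (\<forall>X. direct_sum \<A> X C Us \<longrightarrow> (\<exists>\<epsilon>' \<eta>' \<delta>'. complementary_idempotents \<A> X T \<epsilon>' \<eta>' \<delta>'))"
    if z: "zero_object \<A> (C \<otimes>\<^sub>o Us)" "zero_object \<A> (Us \<otimes>\<^sub>o C)"
  proof (intro conjI allI impI)
    show "T \<simeq> U \<otimes>\<^sub>o Cs" using cone_isomorphic_tensor_unital[OF t s T' z(1)] .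
    fix X assume X: "direct_sum \<A> X C Us"
    obtain f g h where "distinguished \<A> X \<^bold>1 T f g h" using direct_sum_to_middle[OF t s T' X] .
    \<comment> \<open>The summand C is tested on the triangle from Us to U, and Us on the one from C
      to Cs: both remaining terms then vanish, one by complementarity and one by
      \<open>z\<close>.\<close>
    moreover have "zero_object \<A> (X \<otimes>\<^sub>o T)"
      using zero_tensor_direct_sum(2)[OF X distinguishedD(6)[OF T]] zero_tensor_left(1)[OF T' dt(4) z(1) c(1)]
        zero_tensor_left(1)[OF T ds(4) z(2) cs(1)] .
    moreover have "zero_object \<A> (T \<otimes>\<^sub>o X)"
      using zero_tensor_direct_sum(1)[OF X distinguishedD(6)[OF T]] zero_tensor_right(1)[OF T' dt(4) z(2) c(2)]
        zero_tensor_right(1)[OF T ds(4) z(1) cs(2)] .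
    ultimately show "\<exists>\<epsilon>' \<eta>' \<delta>'. complementary_idempotents \<A> X T \<epsilon>' \<eta>' \<delta>'"
      by (auto simp: complementary_idempotents_def isomorphic_to_zero_iff)
  qed
  moreover have "T\<langle>-1\<rangle> \<simeq> C \<otimes>\<^sub>o Us \<and>
      (\<forall>X. direct_sum \<A> X U Cs \<longrightarrow> (\<exists>\<epsilon>' \<eta>' \<delta>'. complementary_idempotents \<A> (T\<langle>-1\<rangle>) X \<epsilon>' \<eta>' \<delta>'))"
    if z: "zero_object \<A> (U \<otimes>\<^sub>o Cs)" "zero_object \<A> (Cs \<otimes>\<^sub>o U)"
  proof (intro conjI allI impI)
    show "T\<langle>-1\<rangle> \<simeq> C \<otimes>\<^sub>o Us" using cone_isomorphic_tensor_counital[OF t s T z(1)] .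
    fix X assume X: "direct_sum \<A> X U Cs"
    have To: "T\<langle>-1\<rangle> \<in> Obj \<A>" using unshift(1) distinguishedD(6)[OF T] .
    obtain f g h where "distinguished \<A> \<^bold>1 X T f g h" using middle_to_direct_sum[OF t s T X] .
    then obtain e where "distinguished \<A> (T\<langle>-1\<rangle>) \<^bold>1 X e f g" using rotate_back by blast
    moreover obtain x where x: "distinguished \<A> (T\<langle>-1\<rangle>) C Cs x (\<epsilon>s \<cdot> \<epsilon>) w" using rotate_back[OF T] .
    moreover obtain y where y: "distinguished \<A> (T\<langle>-1\<rangle>) Us U y (\<eta> \<cdot> \<eta>s) u" using rotate_back[OF T'] .
    \<comment> \<open>With T[-1] as first vertex the pairing is U with the triangle through C and
      Cs, and Cs with the one through Us and U.\<close>
    moreover have "zero_object \<A> (T\<langle>-1\<rangle> \<otimes>\<^sub>o X)"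
      using zero_tensor_direct_sum(1)[OF X To] zero_tensor_right(3)[OF x dt(6) c(1) z(2)]
        zero_tensor_right(3)[OF y ds(6) cs(1) z(1)] .
    moreover have "zero_object \<A> (X \<otimes>\<^sub>o T\<langle>-1\<rangle>)"
      using zero_tensor_direct_sum(2)[OF X To] zero_tensor_left(3)[OF x dt(6) c(2) z(1)]
        zero_tensor_left(3)[OF y ds(6) cs(2) z(2)] .
    ultimately show "\<exists>\<epsilon>' \<eta>' \<delta>'. complementary_idempotents \<A> (T\<langle>-1\<rangle>) X \<epsilon>' \<eta>' \<delta>'"
      by (auto simp: complementary_idempotents_def isomorphic_to_zero_iff)
  qed
  ultimately show ?thesis by (simp add: isomorphic_to_zero_iff)
qed

end
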